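(* Let $\Sigma_H=(M,H,Fe)$ be a Hamiltonian mechanical system. The following properties hold: 1. $\xi$ given in local coordinates by $$\xi=\frac12\left[\frac{\partial H}{\partial p_i}\frac{\partial}{\partial x^i}-\left(\frac{\partial H}{\partial x^i}-F_i\right)\frac{\partial}{\partial p_i}\right]$$ is a (globally defined) vector field on $\widetilde{T^*M}$. 2. $\xi$ is determined only by the Hamiltonian mechanical system $\Sigma_H$. 3. The integral curves of $\xi$ are given by the Hamilton equations $$\frac{dx^i}{dt}-\frac{\partial\mathcal H}{\partial p_i}=0,\qquad \frac{dp_i}{dt}+\frac{\partial\mathcal H}{\partial x^i}=\frac12F_i(x,p),\qquad \mathcal H=\frac12H.$$
   Context: The summation convention is used. $M$ is a real $n$-dimensional smooth manifold, $T^*M$ its cotangent bundle with induced local coordinates $(x^i,p_i)$, and $\widetilde{T^*M}$ is $T^*M$ with the zero section removed. A Hamilton space $H^n=(M,H)$ is given by a function $H:T^*M\to\mathbb R$, smooth on $\widetilde{T^*M}$ and continuous on the zero section, such that $g^{ij}=\frac12\frac{\partial^2H}{\partial p_i\partial p_j}$ is nonsingular and of constant signature on $\widetilde{T^*M}$. A Hamiltonian mechanical system is a triple $\Sigma_H=(M,H,Fe)$ where $(M,H)$ is a Hamilton space and $Fe=F_i(x,p)\frac{\partial}{\partial p_i}$ is a given vertical vector field on $T^*M$ (external forces). *)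

theory Defs
  imports "HOL-Analysis.Analysis"
begin

section \<open>Smooth maps between open subsets of Euclidean spaces\<close>

primrec Ck_on :: "nat \<Rightarrow> 'a::euclidean_space set \<Rightarrow> ('a \<Rightarrow> 'b::real_normed_vector) \<Rightarrow> bool" where
  "Ck_on 0 S f \<longleftrightarrow> continuous_on S f"
| "Ck_on (Suc k) S f \<longleftrightarrow>
     (\<forall>x\<in>S. f differentiable (at x)) \<and> (\<forall>v. Ck_on k S (\<lambda>x. frechet_derivative f (at x) v))"

text \<open>Only meant for open sets, since the derivatives are taken in the full neighbourhood filter.\<close>

definition smooth_on :: "'a::euclidean_space set \<Rightarrow> ('a \<Rightarrow> 'b::real_normed_vector) \<Rightarrow> bool" where
  "smooth_on S f \<longleftrightarrow> (\<forall>k. Ck_on k S f)"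


section \<open>Smooth manifolds\<close>

text \<open>A chart is a pair of its domain and its coordinate map; the values of the coordinate map
  outside the domain are irrelevant.\<close>

type_synonym ('a, 'e) chart = "'a set \<times> ('a \<Rightarrow> 'e)"

record ('a, 'e) manifold =
  mtop :: "'a topology"
  atlas :: "('a, 'e) chart set"

definition is_chart :: "'a topology \<Rightarrow> ('a, 'e::euclidean_space) chart \<Rightarrow> bool" where
  "is_chart T c \<longleftrightarrow> (case c of (U, \<phi>) \<Rightarrow>
     openin T U \<and> open (\<phi> ` U) \<and>
     homeomorphic_map (subtopology T U) (top_of_set (\<phi> ` U)) \<phi>)"

definition compatible :: "('a, 'e::euclidean_space) chart \<Rightarrow> ('a, 'e) chart \<Rightarrow> bool" where
  "compatible c d \<longleftrightarrow> (case c of (U, \<phi>) \<Rightarrow> case d of (V, \<psi>) \<Rightarrow>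
     smooth_on (\<phi> ` (U \<inter> V)) (\<psi> \<circ> inv_into U \<phi>) \<and>
     smooth_on (\<psi> ` (U \<inter> V)) (\<phi> \<circ> inv_into V \<psi>))"

definition smooth_manifold :: "('a, 'e::euclidean_space) manifold \<Rightarrow> bool" where
  "smooth_manifold M \<longleftrightarrow>
     Hausdorff_space (mtop M) \<and> second_countable (mtop M) \<and>
     (\<forall>c\<in>atlas M. is_chart (mtop M) c) \<and>
     (\<Union>c\<in>atlas M. fst c) = topspace (mtop M) \<and>
     (\<forall>c\<in>atlas M. \<forall>d\<in>atlas M. compatible c d) \<and>
     (\<forall>c. is_chart (mtop M) c \<and> (\<forall>d\<in>atlas M. compatible c d) \<longrightarrow> c \<in> atlas M)"

definition smooth_fun_on :: "('a, 'e::euclidean_space) manifold \<Rightarrow> 'a set \<Rightarrow> ('a \<Rightarrow> real) \<Rightarrow> bool" where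
  "smooth_fun_on M W f \<longleftrightarrow>
     (\<forall>(U, \<phi>)\<in>atlas M. smooth_on (\<phi> ` (U \<inter> W)) (f \<circ> inv_into U \<phi>))"

definition smooth_near :: "('a, 'e::euclidean_space) manifold \<Rightarrow> 'a \<Rightarrow> ('a \<Rightarrow> real) \<Rightarrow> bool" where
  "smooth_near M x f \<longleftrightarrow> (\<exists>W. openin (mtop M) W \<and> x \<in> W \<and> smooth_fun_on M W f)"


section \<open>Curves, tangent vectors and vector fields\<close>

definition smooth_curve :: "('a, 'e::euclidean_space) manifold \<Rightarrow> real set \<Rightarrow> (real \<Rightarrow> 'a) \<Rightarrow> bool" where
  "smooth_curve M I \<gamma> \<longleftrightarrow> continuous_map (top_of_set I) (mtop M) \<gamma> \<and>
     (\<forall>(U, \<phi>)\<in>atlas M. smooth_on {t \<in> I. \<gamma> t \<in> U} (\<phi> \<circ> \<gamma>))"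

definition differentiable_curve ::
  "('a, 'e::euclidean_space) manifold \<Rightarrow> real set \<Rightarrow> (real \<Rightarrow> 'a) \<Rightarrow> bool" where
  "differentiable_curve M I \<gamma> \<longleftrightarrow> continuous_map (top_of_set I) (mtop M) \<gamma> \<and>
     (\<forall>(U, \<phi>)\<in>atlas M. \<forall>t\<in>I. \<gamma> t \<in> U \<longrightarrow> (\<phi> \<circ> \<gamma>) differentiable (at t))"

text \<open>Tangent vectors at \<open>x\<close> are the operators on the functions that are smooth near \<open>x\<close> which
  arise as derivatives along smooth curves through \<open>x\<close>.  They are extended by \<open>0\<close> to all other
  functions, so that equality of operators is equality of tangent vectors and the linear structure
  is pointwise.\<close>

type_synonym 'a tvec = "('a \<Rightarrow> real) \<Rightarrow> real"

definition velocity :: "('a, 'e::euclidean_space) manifold \<Rightarrow> (real \<Rightarrow> 'a) \<Rightarrow> real \<Rightarrow> 'a tvec" where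
  "velocity M \<gamma> t = (\<lambda>f. if smooth_near M (\<gamma> t) f then deriv (f \<circ> \<gamma>) t else 0)"

definition tangent_space :: "('a, 'e::euclidean_space) manifold \<Rightarrow> 'a \<Rightarrow> 'a tvec set" where
  "tangent_space M x =
     {velocity M \<gamma> 0 | \<gamma> e. e > 0 \<and> smooth_curve M {-e<..<e} \<gamma> \<and> \<gamma> 0 = x}"

text \<open>The coordinate tangent vector at \<open>x\<close> belonging to the direction \<open>b\<close> of the model space;
  applied to a function, it yields the corresponding partial derivative.\<close>

definition coord_vec ::
  "('a, 'e::euclidean_space) manifold \<Rightarrow> ('a, 'e) chart \<Rightarrow> 'e \<Rightarrow> 'a \<Rightarrow> 'a tvec" where
  "coord_vec M c b x = (case c of (U, \<phi>) \<Rightarrow>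
     (\<lambda>f. if smooth_near M x f then frechet_derivative (f \<circ> inv_into U \<phi>) (at (\<phi> x)) b else 0))"

definition vector_field ::
  "('a, 'e::euclidean_space) manifold \<Rightarrow> 'a set \<Rightarrow> ('a \<Rightarrow> 'a tvec) \<Rightarrow> bool" where
  "vector_field M W X \<longleftrightarrow> openin (mtop M) W \<and>
     (\<forall>x\<in>W. X x \<in> tangent_space M x) \<and>
     (\<forall>V f. openin (mtop M) V \<and> V \<subseteq> W \<and> smooth_fun_on M V f \<longrightarrow> smooth_fun_on M V (\<lambda>x. X x f))"

definition integral_curve ::
  "('a, 'e::euclidean_space) manifold \<Rightarrow> ('a \<Rightarrow> 'a tvec) \<Rightarrow> real set \<Rightarrow> (real \<Rightarrow> 'a) \<Rightarrow> bool" where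
  "integral_curve M X I \<gamma> \<longleftrightarrow>
     differentiable_curve M I \<gamma> \<and> (\<forall>t\<in>I. velocity M \<gamma> t = X (\<gamma> t))"


section \<open>The cotangent bundle\<close>

text \<open>Covectors are linear functionals on the tangent space, extended by \<open>0\<close>.\<close>

definition cotangent_space :: "('a, 'e::euclidean_space) manifold \<Rightarrow> 'a \<Rightarrow> ('a tvec \<Rightarrow> real) set" where
  "cotangent_space M x = {\<alpha>.
     (\<forall>v\<in>tangent_space M x. \<forall>w\<in>tangent_space M x. \<alpha> (\<lambda>f. v f + w f) = \<alpha> v + \<alpha> w) \<and>
     (\<forall>v\<in>tangent_space M x. \<forall>r. \<alpha> (\<lambda>f. r * v f) = r * \<alpha> v) \<and>
     (\<forall>v. v \<notin> tangent_space M x \<longrightarrow> \<alpha> v = 0)}"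

type_synonym 'a cotangent = "'a \<times> ('a tvec \<Rightarrow> real)"

definition cotangent_over :: "('a, 'e::euclidean_space) manifold \<Rightarrow> 'a set \<Rightarrow> 'a cotangent set" where
  "cotangent_over M U = (SIGMA x:U. cotangent_space M x)"

text \<open>The coordinates $(x^i, p_i)$ induced by a chart; $p_i$ is the value of the covector on
  $\partial/\partial x^i$.\<close>

definition induced_chart ::
  "('a, real^'n) manifold \<Rightarrow> ('a, real^'n) chart \<Rightarrow> ('a cotangent, (real^'n) \<times> (real^'n)) chart" where
  "induced_chart M c = (case c of (U, \<phi>) \<Rightarrow>
     (cotangent_over M U, (\<lambda>(x, \<alpha>). (\<phi> x, \<chi> i. \<alpha> (coord_vec M c (axis i 1) x)))))"

definition cotangent_bundle ::
  "('a, real^'n) manifold \<Rightarrow> ('a cotangent, (real^'n) \<times> (real^'n)) manifold" where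
  "cotangent_bundle M = \<lparr>
     mtop = topology_generated_by
       {{u \<in> fst (induced_chart M c). snd (induced_chart M c) u \<in> V} | c V. c \<in> atlas M \<and> open V},
     atlas = induced_chart M ` atlas M\<rparr>"

definition slit_cotangent :: "('a, real^'n) manifold \<Rightarrow> 'a cotangent set" where
  "slit_cotangent M = {(x, \<alpha>). x \<in> topspace (mtop M) \<and> \<alpha> \<in> cotangent_space M x \<and> \<alpha> \<noteq> (\<lambda>_. 0)}"

definition xcoord :: "('a, real^'n) manifold \<Rightarrow> ('a, real^'n) chart \<Rightarrow> 'n \<Rightarrow> 'a cotangent \<Rightarrow> real" where
  "xcoord M c i u = fst (snd (induced_chart M c) u) $ i"

definition pcoord :: "('a, real^'n) manifold \<Rightarrow> ('a, real^'n) chart \<Rightarrow> 'n \<Rightarrow> 'a cotangent \<Rightarrow> real" where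
  "pcoord M c i u = snd (snd (induced_chart M c) u) $ i"

text \<open>The tangent vectors $\partial/\partial x^i$ and $\partial/\partial p_i$ of the cotangent
  bundle.  Thus \<open>dx M c i u f\<close> and \<open>dp M c i u f\<close> are the partial derivatives of \<open>f\<close> at \<open>u\<close>.\<close>

definition dx ::
  "('a, real^'n) manifold \<Rightarrow> ('a, real^'n) chart \<Rightarrow> 'n \<Rightarrow> 'a cotangent \<Rightarrow> 'a cotangent tvec" where
  "dx M c i = coord_vec (cotangent_bundle M) (induced_chart M c) (axis i 1, 0)"

definition dp ::
  "('a, real^'n) manifold \<Rightarrow> ('a, real^'n) chart \<Rightarrow> 'n \<Rightarrow> 'a cotangent \<Rightarrow> 'a cotangent tvec" where
  "dp M c i = coord_vec (cotangent_bundle M) (induced_chart M c) (0, axis i 1)"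


section \<open>Hamiltonian mechanical systems\<close>

text \<open>Signature of a real symmetric matrix: the largest dimensions of a subspace on which its
  quadratic form is positive, respectively negative, definite.\<close>

definition signature :: "real^'n^'n \<Rightarrow> nat \<times> nat" where
  "signature A =
     (Max {dim S | S. subspace S \<and> (\<forall>v\<in>S. v \<noteq> 0 \<longrightarrow> v \<bullet> (A *v v) > 0)},
      Max {dim S | S. subspace S \<and> (\<forall>v\<in>S. v \<noteq> 0 \<longrightarrow> v \<bullet> (A *v v) < 0)})"

definition fundamental_tensor ::
  "('a, real^'n) manifold \<Rightarrow> ('a cotangent \<Rightarrow> real) \<Rightarrow> ('a, real^'n) chart \<Rightarrow> 'a cotangent
     \<Rightarrow> real^'n^'n" where
  "fundamental_tensor M H c u = (\<chi> i j. 1/2 * dp M c i u (\<lambda>w. dp M c j w H))"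

definition hamilton_space :: "('a, real^'n) manifold \<Rightarrow> ('a cotangent \<Rightarrow> real) \<Rightarrow> bool" where
  "hamilton_space M H \<longleftrightarrow> smooth_manifold M \<and>
     smooth_fun_on (cotangent_bundle M) (slit_cotangent M) H \<and>
     continuous_map (mtop (cotangent_bundle M)) euclideanreal H \<and>
     (\<exists>s. \<forall>c\<in>atlas M. \<forall>u \<in> fst (induced_chart M c) \<inter> slit_cotangent M.
        invertible (fundamental_tensor M H c u) \<and> signature (fundamental_tensor M H c u) = s)"

definition force :: "('a, real^'n) manifold \<Rightarrow> ('a cotangent \<Rightarrow> 'a cotangent tvec)
    \<Rightarrow> ('a, real^'n) chart \<Rightarrow> 'n \<Rightarrow> 'a cotangent \<Rightarrow> real" where
  "force M Fe c i u = Fe u (pcoord M c i)"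

definition vertical_field ::
  "('a, real^'n) manifold \<Rightarrow> ('a cotangent \<Rightarrow> 'a cotangent tvec) \<Rightarrow> bool" where
  "vertical_field M Fe \<longleftrightarrow>
     vector_field (cotangent_bundle M) (topspace (mtop (cotangent_bundle M))) Fe \<and>
     (\<forall>c\<in>atlas M. \<forall>u \<in> fst (induced_chart M c).
        Fe u = (\<lambda>f. \<Sum>i\<in>UNIV. force M Fe c i u * dp M c i u f))"

definition mechanical_system :: "('a, real^'n) manifold \<Rightarrow> ('a cotangent \<Rightarrow> real)
    \<Rightarrow> ('a cotangent \<Rightarrow> 'a cotangent tvec) \<Rightarrow> bool" where
  "mechanical_system M H Fe \<longleftrightarrow> hamilton_space M H \<and> vertical_field M Fe"

definition local_field :: "('a, real^'n) manifold \<Rightarrow> ('a cotangent \<Rightarrow> real)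
    \<Rightarrow> ('a cotangent \<Rightarrow> 'a cotangent tvec) \<Rightarrow> ('a, real^'n) chart
    \<Rightarrow> 'a cotangent \<Rightarrow> 'a cotangent tvec" where
  "local_field M H Fe c u = (\<lambda>f. 1/2 * (\<Sum>i\<in>UNIV.
     dp M c i u H * dx M c i u f - (dx M c i u H - force M Fe c i u) * dp M c i u f))"

definition has_local_expression :: "('a, real^'n) manifold \<Rightarrow> ('a cotangent \<Rightarrow> real)
    \<Rightarrow> ('a cotangent \<Rightarrow> 'a cotangent tvec) \<Rightarrow> ('a, real^'n) chart
    \<Rightarrow> ('a cotangent \<Rightarrow> 'a cotangent tvec) \<Rightarrow> bool" where
  "has_local_expression M H Fe c X \<longleftrightarrow>
     (\<forall>u \<in> fst (induced_chart M c) \<inter> slit_cotangent M. X u = local_field M H Fe c u)"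

definition hamilton_equations :: "('a, real^'n) manifold \<Rightarrow> ('a cotangent \<Rightarrow> real)
    \<Rightarrow> ('a cotangent \<Rightarrow> 'a cotangent tvec) \<Rightarrow> ('a, real^'n) chart
    \<Rightarrow> (real \<Rightarrow> 'a cotangent) \<Rightarrow> real \<Rightarrow> bool" where
  "hamilton_equations M H Fe c \<gamma> t \<longleftrightarrow> (\<forall>i.
     (xcoord M c i \<circ> \<gamma>) differentiable (at t) \<and> (pcoord M c i \<circ> \<gamma>) differentiable (at t) \<and>
     deriv (xcoord M c i \<circ> \<gamma>) t - dp M c i (\<gamma> t) (\<lambda>w. 1/2 * H w) = 0 \<and>
     deriv (pcoord M c i \<circ> \<gamma>) t + dx M c i (\<gamma> t) (\<lambda>w. 1/2 * H w) = 1/2 * force M Fe c i (\<gamma> t))"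

end

theory Submission
  imports Defs
begin

text \<open>
  Why the theorem holds.  In induced coordinates, $2\xi$ is the sum of the Hamiltonian vector field
  $X_H = \frac{\partial H}{\partial p_i}\frac{\partial}{\partial x^i}
       - \frac{\partial H}{\partial x^i}\frac{\partial}{\partial p_i}$
  and of the force field $F_i\frac{\partial}{\partial p_i}$.  The second summand is the given field
  \<open>Fe\<close>, which is global by assumption.  So $\xi$ is well defined if the coordinate expression of
  $X_H$ does not depend on the chart.

  This is the invariance of the canonical symplectic form $\omega = \sum_i dx^i\wedge dp_i$ under
  transitions of induced coordinates (\<open>symplectic_form_invariant\<close>).  The momenta transform such that
  the pairing of a covector with a tangent vector is preserved, that is
  $\tilde p\cdot D\tau(x)v = p\cdot v$ for the transition map $\tau$ of the base.  Differentiating this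
  identity and using that second derivatives are symmetric gives the invariance of $\omega$.  As
  $X_H$ is characterised by $\omega(X_H, w) = dH(w)$ for all $w$, and $\omega$ is nondegenerate, $X_H$
  is independent of the chart (\<open>ham_vec_invariant\<close>).

  The components of $\xi$ in a chart are built from first derivatives of $H$, which is smooth off
  the zero section, and from the values of the vector field \<open>Fe\<close> on the functions $p_i$.  They are
  therefore smooth, and $\xi$ is a vector field (\<open>vector_field_evolution\<close>).  A field with the same
  local expressions in charts covering the manifold coincides with $\xi$ off the zero section.
  Finally, the components of the velocity of a curve are the derivatives of its coordinates, so
  comparing components turns the equation of integral curves into Hamilton's equations
  (\<open>integral_curve_iff_hamilton_equations\<close>).

  In order to speak of tangent vectors of the cotangent bundle, the induced charts have to be
  recognised as charts with smooth transition maps (\<open>smooth_atlas_cotangent_bundle\<close>).  The general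
  facts on coordinate vectors, velocities and vector fields then apply to the manifold and to
  its bundle alike.
\<close>

section \<open>Calculus of smooth maps\<close>

lemma Ck_on_subset: "Ck_on k S f \<Longrightarrow> T \<subseteq> S \<Longrightarrow> Ck_on k T f"
  by (induction k arbitrary: f) (auto intro: continuous_on_subset)

text \<open>Openness cannot be dropped: \<^const>\<open>Ck_on\<close> differentiates in full neighbourhoods, and
  the derivatives of two functions that agree on a set can differ except at its interior points.\<close>

lemma Ck_on_cong:
  assumes "open S" "\<And>x. x \<in> S \<Longrightarrow> f x = g x" "Ck_on k S f"
  shows "Ck_on k S g"
  using assms(2,3)
proof (induction k arbitrary: f g)
  case 0
  then show ?case by (auto cong: continuous_on_cong)
next
  case (Suc k)
  have d: "(g has_derivative frechet_derivative f (at x)) (at x)" if "x \<in> S" for x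
    using Suc.prems that assms(1)
    by (metis Ck_on.simps(2) frechet_derivative_works has_derivative_transform_within_open)
  have eq: "frechet_derivative f (at x) v = frechet_derivative g (at x) v" if "x \<in> S" for x v
    using frechet_derivative_at[OF d[OF that]] by simp
  have "Ck_on k S (\<lambda>x. frechet_derivative f (at x) v)" for v
    using Suc.prems(2) by simp
  then have "Ck_on k S (\<lambda>x. frechet_derivative g (at x) v)" for v
    using Suc.IH[of "\<lambda>x. frechet_derivative f (at x) v" "\<lambda>x. frechet_derivative g (at x) v"] eq
    by blast
  with d show ?case by (auto simp: differentiable_def)
qed

text \<open>This form allows any explicit formula for the derivative, so that the induction steps
  below can use the sum, product and chain rules directly.\<close>

lemma Ck_on_SucI:
  assumes "open S" "\<And>x. x \<in> S \<Longrightarrow> (f has_derivative f' x) (at x)"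
    and "\<And>v. Ck_on k S (\<lambda>x. f' x v)"
  shows "Ck_on (Suc k) S f"
proof -
  have "f' x = frechet_derivative f (at x)" if "x \<in> S" for x
    using assms(2)[OF that] by (rule frechet_derivative_at)
  then have "Ck_on k S (\<lambda>x. frechet_derivative f (at x) v)" for v
    by (intro Ck_on_cong[OF assms(1) _ assms(3)[of v]]) (rule fun_cong)
  with assms(2) show ?thesis by (auto simp: differentiable_def)
qed

lemma Ck_on_Suc_D: "Ck_on (Suc k) S f \<Longrightarrow> Ck_on k S f"
proof (induction k arbitrary: f)
  case 0
  then show ?case
    by (simp add: continuous_at_imp_continuous_on differentiable_imp_continuous_within)
next
  case (Suc k)
  then show ?case by (metis Ck_on.simps(2))
qed

lemma Ck_on_const: "Ck_on k S (\<lambda>x. c)"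
  by (induction k arbitrary: c) (auto intro: continuous_on_const)

lemma Ck_on_add:
  assumes "open S" "Ck_on k S f" "Ck_on k S g"
  shows "Ck_on k S (\<lambda>x. f x + g x)"
  using assms(2,3)
proof (induction k arbitrary: f g)
  case 0
  then show ?case by (auto intro: continuous_intros)
next
  case (Suc k)
  show ?case
    by (rule Ck_on_SucI[OF assms(1),
          where f' = "\<lambda>x v. frechet_derivative f (at x) v + frechet_derivative g (at x) v"])
      (use Suc in \<open>auto intro!: has_derivative_add simp flip: frechet_derivative_works\<close>)
qed

lemma Ck_on_bilinear:
  assumes "bounded_bilinear b" "open S" "Ck_on k S f" "Ck_on k S g"
  shows "Ck_on k S (\<lambda>x. b (f x) (g x))"
  using assms(3,4)
proof (induction k arbitrary: f g)
  case 0
  then show ?case by (auto intro: bounded_bilinear.continuous_on[OF assms(1)])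
next
  case (Suc k)
  have k: "Ck_on k S f" "Ck_on k S g"
    using Suc.prems by (auto dest: Ck_on_Suc_D simp del: Ck_on.simps)
  show ?case
  proof (rule Ck_on_SucI[OF assms(2)])
    show "((\<lambda>x. b (f x) (g x)) has_derivative
        (\<lambda>v. b (f x) (frechet_derivative g (at x) v) + b (frechet_derivative f (at x) v) (g x))) (at x)"
      if "x \<in> S" for x
      using Suc.prems that
      by (intro bounded_bilinear.FDERIV[OF assms(1)]) (auto simp flip: frechet_derivative_works)
    show "Ck_on k S (\<lambda>x. b (f x) (frechet_derivative g (at x) v)
        + b (frechet_derivative f (at x) v) (g x))" for v
      using Suc.prems k by (intro Ck_on_add[OF assms(2)] Suc.IH) auto
  qed
qed

lemma Ck_on_sum:
  assumes "open S" "\<And>i. i \<in> I \<Longrightarrow> Ck_on k S (f i)"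
  shows "Ck_on k S (\<lambda>x. \<Sum>i\<in>I. f i x)"
  using assms(2)
  by (induction I rule: infinite_finite_induct) (auto intro: Ck_on_add[OF assms(1)] Ck_on_const)

text \<open>The chain rule writes a directional derivative of \<open>g \<circ> f\<close> as a sum, over a basis \<open>b\<close>, of
  products of components of the derivative of \<open>f\<close> with the compositions \<open>(D\<^sub>b g) \<circ> f\<close>.  The latter are
  covered by the induction hypothesis, because it is stated for all \<open>g\<close>.\<close>

lemma Ck_on_compose:
  fixes f :: "'a::euclidean_space \<Rightarrow> 'b::euclidean_space"
  assumes "open S" "f ` S \<subseteq> T" "Ck_on k S f" "Ck_on k T g"
  shows "Ck_on k S (\<lambda>x. g (f x))"
  using assms(3,4)
proof (induction k arbitrary: g)
  case 0
  then show ?case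
    using continuous_on_compose2[of T g S f] assms(2) by (simp add: image_subset_iff)
next
  case (Suc k)
  have fk: "Ck_on k S f" using Suc.prems(1) by (rule Ck_on_Suc_D)
  let ?F = "\<lambda>x. frechet_derivative f (at x)" and ?G = "\<lambda>y. frechet_derivative g (at y)"
  show ?case
  proof (rule Ck_on_SucI[OF assms(1)])
    fix x assume x: "x \<in> S"
    then have "f x \<in> T" using assms(2) by blast
    with x Suc.prems have d: "(f has_derivative ?F x) (at x)" "(g has_derivative ?G (f x)) (at (f x))"
      by (simp_all flip: frechet_derivative_works)
    have lin: "linear (?G (f x))" using d(2) by (rule has_derivative_linear)
    have rep: "?G (f x) w = (\<Sum>b\<in>Basis. (w \<bullet> b) *\<^sub>R ?G (f x) b)" for w
      using linear_sum[OF lin, of "\<lambda>b. (w \<bullet> b) *\<^sub>R b" Basis]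
      by (simp add: euclidean_representation linear_scale[OF lin])
    have "?G (f x) \<circ> ?F x = (\<lambda>v. \<Sum>b\<in>Basis. (?F x v \<bullet> b) *\<^sub>R ?G (f x) b)"
      unfolding o_def by (intro ext rep)
    with diff_chain_at[OF d]
    show "((\<lambda>x. g (f x)) has_derivative (\<lambda>v. \<Sum>b\<in>Basis. (?F x v \<bullet> b) *\<^sub>R ?G (f x) b)) (at x)"
      by (simp only: o_def)
  next
    fix v
    have "Ck_on k S (\<lambda>x. ?G (f x) b)" for b
      using Suc.prems fk by (intro Suc.IH) auto
    moreover have "Ck_on k S (\<lambda>x. ?F x v \<bullet> b)" for b
      using Suc.prems by (intro Ck_on_bilinear[OF bounded_bilinear_inner assms(1)] Ck_on_const) auto
    ultimately show "Ck_on k S (\<lambda>x. \<Sum>b\<in>Basis. (?F x v \<bullet> b) *\<^sub>R ?G (f x) b)"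
      by (intro Ck_on_sum[OF assms(1)] Ck_on_bilinear[OF bounded_bilinear_scaleR assms(1)])
  qed
qed

lemma Ck_on_linear: "bounded_linear f \<Longrightarrow> Ck_on k S f"
proof -
  assume f: "bounded_linear f"
  then have "frechet_derivative f (at x) = f" for x
    by (metis bounded_linear_imp_has_derivative frechet_derivative_at)
  then show ?thesis
    using f by (cases k) (auto simp: Ck_on_const linear_continuous_on bounded_linear_imp_differentiable)
qed

lemma smooth_on_subset: "smooth_on S f \<Longrightarrow> T \<subseteq> S \<Longrightarrow> smooth_on T f"
  by (auto simp: smooth_on_def intro: Ck_on_subset)

lemma smooth_on_cong:
  "open S \<Longrightarrow> (\<And>x. x \<in> S \<Longrightarrow> f x = g x) \<Longrightarrow> smooth_on S f \<Longrightarrow> smooth_on S g"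
  by (auto simp: smooth_on_def intro: Ck_on_cong)

lemma smooth_on_const: "smooth_on S (\<lambda>x. c)"
  by (auto simp: smooth_on_def intro: Ck_on_const)

lemma smooth_on_linear: "bounded_linear f \<Longrightarrow> smooth_on S f"
  by (auto simp: smooth_on_def intro: Ck_on_linear)

lemma smooth_on_add:
  "open S \<Longrightarrow> smooth_on S f \<Longrightarrow> smooth_on S g \<Longrightarrow> smooth_on S (\<lambda>x. f x + g x)"
  by (auto simp: smooth_on_def intro: Ck_on_add)

lemma smooth_on_sum:
  "open S \<Longrightarrow> (\<And>i. i \<in> I \<Longrightarrow> smooth_on S (f i)) \<Longrightarrow> smooth_on S (\<lambda>x. \<Sum>i\<in>I. f i x)"
  by (auto simp: smooth_on_def intro: Ck_on_sum)

lemma smooth_on_bilinear: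
  "bounded_bilinear b \<Longrightarrow> open S \<Longrightarrow> smooth_on S f \<Longrightarrow> smooth_on S g
    \<Longrightarrow> smooth_on S (\<lambda>x. b (f x) (g x))"
  by (auto simp: smooth_on_def intro: Ck_on_bilinear)

lemmas smooth_on_scaleR = smooth_on_bilinear[OF bounded_bilinear_scaleR]
  and smooth_on_inner = smooth_on_bilinear[OF bounded_bilinear_inner]
lemma smooth_on_mult:
  fixes f g :: "'a::euclidean_space \<Rightarrow> real"
  shows "open S \<Longrightarrow> smooth_on S f \<Longrightarrow> smooth_on S g \<Longrightarrow> smooth_on S (\<lambda>x. f x * g x)"
  by (rule smooth_on_bilinear[OF bounded_bilinear_mult])

lemma smooth_on_compose:
  fixes f :: "'a::euclidean_space \<Rightarrow> 'b::euclidean_space"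
  shows "open S \<Longrightarrow> f ` S \<subseteq> T \<Longrightarrow> smooth_on S f \<Longrightarrow> smooth_on T g \<Longrightarrow> smooth_on S (\<lambda>x. g (f x))"
  unfolding smooth_on_def using Ck_on_compose[of S f T _ g] by blast

lemma sum_axis: "(\<Sum>i\<in>UNIV. a $ i *\<^sub>R axis i 1) = (a :: real^'n)"
  using basis_expansion[of a] by (simp add: scalar_mult_eq_scaleR)

lemma smooth_on_Pair:
  fixes f :: "'a::euclidean_space \<Rightarrow> 'b::euclidean_space" and g :: "'a \<Rightarrow> 'c::euclidean_space"
  assumes "open S" "smooth_on S f" "smooth_on S g"
  shows "smooth_on S (\<lambda>x. (f x, g x))"
proof -
  have l: "bounded_linear (\<lambda>y::'b. (y, 0::'c))" "bounded_linear (\<lambda>y::'c. (0::'b, y))"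
    by (intro bounded_linear_Pair bounded_linear_ident bounded_linear_zero)+
  have "smooth_on S (\<lambda>x. (f x, 0::'c))" "smooth_on S (\<lambda>x. (0::'b, g x))"
    by (rule smooth_on_compose[OF assms(1) subset_UNIV assms(2) smooth_on_linear[OF l(1)]],
        rule smooth_on_compose[OF assms(1) subset_UNIV assms(3) smooth_on_linear[OF l(2)]])
  from smooth_on_add[OF assms(1) this] show ?thesis by simp
qed

lemma smooth_on_vec_lambda:
  fixes f :: "'n::finite \<Rightarrow> 'a::euclidean_space \<Rightarrow> real"
  assumes "open S" "\<And>i. smooth_on S (f i)"
  shows "smooth_on S (\<lambda>x. \<chi> i. f i x)"
proof -
  have "smooth_on S (\<lambda>x. \<Sum>i\<in>UNIV. f i x *\<^sub>R axis i (1::real))"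
    using assms by (intro smooth_on_sum smooth_on_scaleR smooth_on_const)
  moreover have "(\<Sum>i\<in>UNIV. f i x *\<^sub>R axis i (1::real)) = (\<chi> i. f i x)" for x
    using sum_axis[of "\<chi> i. f i x"] by simp
  ultimately show ?thesis by simp
qed

lemma smooth_on_has_derivative:
  "smooth_on S f \<Longrightarrow> x \<in> S \<Longrightarrow> (f has_derivative frechet_derivative f (at x)) (at x)"
  unfolding smooth_on_def by (metis Ck_on.simps(2) frechet_derivative_works)

lemma smooth_on_frechet_derivative:
  "smooth_on S f \<Longrightarrow> smooth_on S (\<lambda>x. frechet_derivative f (at x) v)"
  unfolding smooth_on_def by (metis Ck_on.simps(2))

lemma smooth_on_continuous_on: "smooth_on S f \<Longrightarrow> continuous_on S f"
  unfolding smooth_on_def by (metis Ck_on.simps(1))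

lemma frechet_derivative_cong_open:
  "open S \<Longrightarrow> x \<in> S \<Longrightarrow> (\<And>y. y \<in> S \<Longrightarrow> f y = g y) \<Longrightarrow> (f has_derivative f') (at x)
    \<Longrightarrow> frechet_derivative g (at x) = f'"
  by (metis frechet_derivative_at has_derivative_transform_within_open)

text \<open>The second difference of \<open>h\<close> over a parallelogram is evaluated by the mean value theorem,
  first along \<open>a\<close> and then along \<open>v\<close>.  As the second difference is symmetric in \<open>a\<close> and \<open>v\<close>,
  shrinking the parallelogram gives the symmetry of the second derivative.\<close>

lemma second_difference_mvt:
  fixes h :: "'a::euclidean_space \<Rightarrow> real"
  assumes S: "smooth_on S h" and s: "0 < s"
    and in_S: "\<And>\<xi> \<eta>. 0 \<le> \<xi> \<Longrightarrow> \<xi> \<le> s \<Longrightarrow> 0 \<le> \<eta> \<Longrightarrow> \<eta> \<le> s \<Longrightarrow> y + \<xi> *\<^sub>R a + \<eta> *\<^sub>R v \<in> S"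
  shows "\<exists>\<xi>\<in>{0..s}. \<exists>\<eta>\<in>{0..s}.
    h (y + s *\<^sub>R a + s *\<^sub>R v) - h (y + s *\<^sub>R a) - (h (y + s *\<^sub>R v) - h y)
    = s * s * frechet_derivative (\<lambda>z. frechet_derivative h (at z) a) (at (y + \<xi> *\<^sub>R a + \<eta> *\<^sub>R v)) v"
proof -
  let ?D = "\<lambda>z. frechet_derivative h (at z)"
  have lin: "linear (?D z)" if "z \<in> S" for z
    using smooth_on_has_derivative[OF S that] by (rule has_derivative_linear)
  define g where "g \<xi> = h (y + \<xi> *\<^sub>R a + s *\<^sub>R v) - h (y + \<xi> *\<^sub>R a + 0 *\<^sub>R v)" for \<xi>
  have line: "((\<lambda>\<xi>. h (y + \<xi> *\<^sub>R a + \<eta> *\<^sub>R v)) has_real_derivative ?D (y + \<xi> *\<^sub>R a + \<eta> *\<^sub>R v) a) (at \<xi>)"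
    if "0 \<le> \<xi>" "\<xi> \<le> s" "0 \<le> \<eta>" "\<eta> \<le> s" for \<xi> \<eta>
  proof -
    have "((\<lambda>\<xi>. y + \<xi> *\<^sub>R a + \<eta> *\<^sub>R v) has_derivative (\<lambda>r. r *\<^sub>R a)) (at \<xi>)"
      by (auto intro!: derivative_eq_intros)
    from diff_chain_at[OF this smooth_on_has_derivative[OF S in_S[OF that]]]
    show ?thesis
      using lin[OF in_S[OF that]]
      by (simp add: has_field_derivative_def o_def linear_scale mult.commute[of _ "?D _ a"] lambda_one)
  qed
  have "\<exists>\<xi>>0. \<xi> < s \<and> g s - g 0
      = (s - 0) * (?D (y + \<xi> *\<^sub>R a + s *\<^sub>R v) a - ?D (y + \<xi> *\<^sub>R a + 0 *\<^sub>R v) a)"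
    unfolding g_def using s by (intro MVT2) (auto intro!: DERIV_diff line simp del: scaleR_zero_left)
  then obtain \<xi> where \<xi>: "0 < \<xi>" "\<xi> < s"
    "g s - g 0 = s * (?D (y + \<xi> *\<^sub>R a + s *\<^sub>R v) a - ?D (y + \<xi> *\<^sub>R a + 0 *\<^sub>R v) a)"
    by auto
  let ?E = "\<lambda>z. frechet_derivative (\<lambda>z. ?D z a) (at z)"
  have S': "smooth_on S (\<lambda>z. ?D z a)" using S by (rule smooth_on_frechet_derivative)
  have line': "((\<lambda>\<eta>. ?D (y + \<xi> *\<^sub>R a + \<eta> *\<^sub>R v) a) has_real_derivative ?E (y + \<xi> *\<^sub>R a + \<eta> *\<^sub>R v) v) (at \<eta>)"
    if "0 \<le> \<eta>" "\<eta> \<le> s" for \<eta>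
  proof -
    have z: "y + \<xi> *\<^sub>R a + \<eta> *\<^sub>R v \<in> S" using \<xi> that in_S by auto
    have "((\<lambda>\<eta>. y + \<xi> *\<^sub>R a + \<eta> *\<^sub>R v) has_derivative (\<lambda>r. r *\<^sub>R v)) (at \<eta>)"
      by (auto intro!: derivative_eq_intros)
    from diff_chain_at[OF this smooth_on_has_derivative[OF S' z]]
    show ?thesis
      using has_derivative_linear[OF smooth_on_has_derivative[OF S' z]]
      by (simp add: has_field_derivative_def o_def linear_scale mult.commute[of _ "?E _ v"])
  qed
  have "\<exists>\<eta>>0. \<eta> < s \<and> ?D (y + \<xi> *\<^sub>R a + s *\<^sub>R v) a - ?D (y + \<xi> *\<^sub>R a + 0 *\<^sub>R v) a
      = (s - 0) * ?E (y + \<xi> *\<^sub>R a + \<eta> *\<^sub>R v) v"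
    using s by (intro MVT2) (auto intro!: line' simp del: scaleR_zero_left)
  then obtain \<eta> where \<eta>: "0 < \<eta>" "\<eta> < s"
    "?D (y + \<xi> *\<^sub>R a + s *\<^sub>R v) a - ?D (y + \<xi> *\<^sub>R a + 0 *\<^sub>R v) a = s * ?E (y + \<xi> *\<^sub>R a + \<eta> *\<^sub>R v) v"
    by auto
  with \<xi> show ?thesis
    by (intro bexI[of _ \<xi>] bexI[of _ \<eta>]) (auto simp: g_def)
qed

lemma smooth_on_second_derivative_symmetric_real:
  fixes h :: "'a::euclidean_space \<Rightarrow> real"
  assumes "open S" "smooth_on S h" "y \<in> S"
  shows "frechet_derivative (\<lambda>z. frechet_derivative h (at z) a) (at y) v
    = frechet_derivative (\<lambda>z. frechet_derivative h (at z) v) (at y) a"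
proof -
  define E where "E a v z = frechet_derivative (\<lambda>z. frechet_derivative h (at z) a) (at z) v" for a v z
  have cont: "isCont (E a v) y" for a v
    unfolding E_def using assms
    by (metis continuous_on_eq_continuous_at smooth_on_continuous_on smooth_on_frechet_derivative)
  have "\<bar>E a v y - E v a y\<bar> \<le> 0"
  proof (rule field_le_epsilon)
    fix e :: real assume e: "0 < e"
    obtain r where r: "r > 0" "ball y r \<subseteq> S" using assms openE by blast
    obtain d1 where d1: "d1 > 0" "\<And>z. dist z y < d1 \<Longrightarrow> dist (E a v z) (E a v y) < e/2"
      using cont[of a v] e by (metis continuous_at_eps_delta half_gt_zero)
    obtain d2 where d2: "d2 > 0" "\<And>z. dist z y < d2 \<Longrightarrow> dist (E v a z) (E v a y) < e/2"
      using cont[of v a] e by (metis continuous_at_eps_delta half_gt_zero)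
    define d where "d = min r (min d1 d2)"
    \<comment> \<open>A side length for which the whole parallelogram lies within \<open>d\<close> of \<open>y\<close>.\<close>
    define s where "s = d / (2 * (1 + norm a + norm v))"
    have d: "d > 0" using r d1 d2 by (simp add: d_def)
    have N: "1 + norm a + norm v > 0" by (smt (verit) norm_ge_zero)
    have s: "s > 0" using d N by (simp add: s_def)
    have near: "dist (y + \<xi> *\<^sub>R a + \<eta> *\<^sub>R v) y < d" if "0 \<le> \<xi>" "\<xi> \<le> s" "0 \<le> \<eta>" "\<eta> \<le> s" for \<xi> \<eta>
    proof -
      have "dist (y + \<xi> *\<^sub>R a + \<eta> *\<^sub>R v) y = norm (\<xi> *\<^sub>R a + \<eta> *\<^sub>R v)"
        by (simp add: dist_norm algebra_simps)
      also have "\<dots> \<le> norm (\<xi> *\<^sub>R a) + norm (\<eta> *\<^sub>R v)" by (rule norm_triangle_ineq)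
      also have "\<dots> \<le> s * norm a + s * norm v"
        using that by (auto intro!: add_mono mult_right_mono)
      also have "\<dots> < s * (2 * (1 + norm a + norm v))"
        using s norm_ge_zero[of a] norm_ge_zero[of v]
        by (simp add: algebra_simps add_pos_nonneg add_strict_increasing2)
      also have "\<dots> = d" using N by (simp add: s_def)
      finally show ?thesis .
    qed
    have in_S: "y + \<xi> *\<^sub>R a + \<eta> *\<^sub>R v \<in> S" "y + \<eta> *\<^sub>R v + \<xi> *\<^sub>R a \<in> S"
      if "0 \<le> \<xi>" "\<xi> \<le> s" "0 \<le> \<eta>" "\<eta> \<le> s" for \<xi> \<eta>
      using near[OF that] r by (auto simp: d_def dist_commute add_ac subset_iff)
    obtain \<xi> \<eta> where 1: "\<xi> \<in> {0..s}" "\<eta> \<in> {0..s}"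
      "h (y + s *\<^sub>R a + s *\<^sub>R v) - h (y + s *\<^sub>R a) - (h (y + s *\<^sub>R v) - h y)
        = s * s * E a v (y + \<xi> *\<^sub>R a + \<eta> *\<^sub>R v)"
      using second_difference_mvt[OF assms(2) s in_S(1)] unfolding E_def by blast
    obtain \<xi>' \<eta>' where 2: "\<xi>' \<in> {0..s}" "\<eta>' \<in> {0..s}"
      "h (y + s *\<^sub>R v + s *\<^sub>R a) - h (y + s *\<^sub>R v) - (h (y + s *\<^sub>R a) - h y)
        = s * s * E v a (y + \<eta>' *\<^sub>R v + \<xi>' *\<^sub>R a)"
      using second_difference_mvt[OF assms(2) s, of y v a] in_S(2) unfolding E_def by blast
    have "s * s * E a v (y + \<xi> *\<^sub>R a + \<eta> *\<^sub>R v) = s * s * E v a (y + \<eta>' *\<^sub>R v + \<xi>' *\<^sub>R a)"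
      using 1 2 by (simp add: algebra_simps)
    then have eq: "E a v (y + \<xi> *\<^sub>R a + \<eta> *\<^sub>R v) = E v a (y + \<xi>' *\<^sub>R a + \<eta>' *\<^sub>R v)"
      using s by (simp add: add_ac)
    have "dist (E a v (y + \<xi> *\<^sub>R a + \<eta> *\<^sub>R v)) (E a v y) < e/2"
      using near[of \<xi> \<eta>] 1 by (intro d1(2)) (simp add: d_def)
    moreover have "dist (E v a (y + \<xi>' *\<^sub>R a + \<eta>' *\<^sub>R v)) (E v a y) < e/2"
      using near[of \<xi>' \<eta>'] 2 by (intro d2(2)) (simp add: d_def)
    ultimately show "\<bar>E a v y - E v a y\<bar> \<le> 0 + e"
      unfolding eq dist_real_def by linarith
  qed
  then show ?thesis by (simp add: E_def)
qed

lemma smooth_on_second_derivative_symmetric: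
  fixes f :: "'a::euclidean_space \<Rightarrow> 'b::euclidean_space"
  assumes S: "open S" "smooth_on S f" "y \<in> S"
  shows "frechet_derivative (\<lambda>z. frechet_derivative f (at z) a) (at y) v
    = frechet_derivative (\<lambda>z. frechet_derivative f (at z) v) (at y) a"
proof (rule euclidean_eqI)
  fix i :: 'b assume "i \<in> Basis"
  have inner: "frechet_derivative (\<lambda>x. g x \<bullet> i) (at z) w = frechet_derivative g (at z) w \<bullet> i"
    if "smooth_on S g" "z \<in> S" for g :: "'a \<Rightarrow> 'b" and z w
    using frechet_derivative_at[OF has_derivative_inner_left[OF smooth_on_has_derivative[OF that]]]
    by metis
  have second: "frechet_derivative (\<lambda>z. frechet_derivative (\<lambda>x. f x \<bullet> i) (at z) a) (at y) v
      = frechet_derivative (\<lambda>z. frechet_derivative f (at z) a) (at y) v \<bullet> i" for a v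
  proof -
    have s: "smooth_on S (\<lambda>z. frechet_derivative f (at z) a)"
      using S(2) by (rule smooth_on_frechet_derivative)
    have "frechet_derivative (\<lambda>z. frechet_derivative (\<lambda>x. f x \<bullet> i) (at z) a) (at y)
        = (\<lambda>v. frechet_derivative (\<lambda>z. frechet_derivative f (at z) a) (at y) v \<bullet> i)"
      by (rule frechet_derivative_cong_open[OF S(1,3) _
            has_derivative_inner_left[OF smooth_on_has_derivative[OF s S(3)]]])
        (simp add: inner[OF S(2)])
    then show ?thesis by simp
  qed
  have "smooth_on S (\<lambda>x. f x \<bullet> i)"
    using S by (intro smooth_on_inner smooth_on_const)
  from smooth_on_second_derivative_symmetric_real[OF S(1) this S(3), of a v]
  show "frechet_derivative (\<lambda>z. frechet_derivative f (at z) a) (at y) v \<bullet> i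
      = frechet_derivative (\<lambda>z. frechet_derivative f (at z) v) (at y) a \<bullet> i"
    unfolding second .
qed

section \<open>Smooth atlases and tangent vectors\<close>

text \<open>The atlas of \<^const>\<open>cotangent_bundle\<close> consists of the induced charts only and need not
  be maximal.  Tangent vectors, velocities and vector fields are therefore studied for any cover by
  charts with smooth transition maps, so that the results hold for the manifold and for its
  cotangent bundle.\<close>

locale smooth_atlas =
  fixes M :: "('a, 'e::euclidean_space) manifold"
  assumes charts: "c \<in> atlas M \<Longrightarrow> is_chart (mtop M) c"
    and cover: "(\<Union>c\<in>atlas M. fst c) = topspace (mtop M)"
    and compat: "c \<in> atlas M \<Longrightarrow> d \<in> atlas M \<Longrightarrow> compatible c d"
begin

context
  fixes U \<phi>
  assumes chart: "(U, \<phi>) \<in> atlas M"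
begin

lemma openin_chart_domain: "openin (mtop M) U"
  and open_chart_image: "open (\<phi> ` U)"
  and homeomorphic_chart: "homeomorphic_map (subtopology (mtop M) U) (top_of_set (\<phi> ` U)) \<phi>"
  using charts[OF chart] by (auto simp: is_chart_def)

lemma chart_domain_subset: "U \<subseteq> topspace (mtop M)"
  using openin_chart_domain by (rule openin_subset)

lemma inj_on_chart: "inj_on \<phi> U"
  using homeomorphic_imp_injective_map[OF homeomorphic_chart] chart_domain_subset
  by (simp add: topspace_subtopology Int_absorb1)

lemma inv_chart [simp]: "x \<in> U \<Longrightarrow> inv_into U \<phi> (\<phi> x) = x"
  using inj_on_chart by (rule inv_into_f_f)

lemma open_chart_image_Int:
  assumes "openin (mtop M) W"
  shows "open (\<phi> ` (U \<inter> W))"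
proof -
  have "openin (subtopology (mtop M) U) (U \<inter> W)"
    using assms by (metis inf_commute openin_subtopology_Int)
  then have "openin (top_of_set (\<phi> ` U)) (\<phi> ` (U \<inter> W))"
    using homeomorphic_imp_open_map[OF homeomorphic_chart] by (simp add: open_map_def)
  then show ?thesis using open_chart_image openin_open_eq by blast
qed

lemma continuous_map_inv_chart: "continuous_map (top_of_set (\<phi> ` U)) (mtop M) (inv_into U \<phi>)"
proof -
  obtain g where g: "homeomorphic_maps (subtopology (mtop M) U) (top_of_set (\<phi> ` U)) \<phi> g"
    using homeomorphic_chart homeomorphic_map_maps by blast
  then have "continuous_map (top_of_set (\<phi> ` U)) (subtopology (mtop M) U) g"
    and "\<forall>x\<in>topspace (subtopology (mtop M) U). g (\<phi> x) = x"
    by (simp_all add: homeomorphic_maps_def)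
  moreover have "topspace (subtopology (mtop M) U) = U"
    using chart_domain_subset by (simp add: topspace_subtopology Int_absorb1)
  ultimately have "continuous_map (top_of_set (\<phi> ` U)) (mtop M) g" "\<forall>x\<in>U. g (\<phi> x) = x"
    using continuous_map_in_subtopology by (blast, simp)
  then show ?thesis
    by (elim continuous_map_eq) auto
qed

lemma smooth_transition:
  assumes "(V, \<psi>) \<in> atlas M"
  shows "smooth_on (\<phi> ` (U \<inter> V)) (\<psi> \<circ> inv_into U \<phi>)"
  using compat[OF chart assms] by (simp add: compatible_def)

lemma smooth_fun_on_chart:
  assumes "smooth_fun_on M W f"
  shows "smooth_on (\<phi> ` (U \<inter> W)) (f \<circ> inv_into U \<phi>)"
  using assms chart by (auto simp: smooth_fun_on_def)

lemma smooth_near_has_derivative: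
  assumes "smooth_near M x f" "x \<in> U"
  shows "((f \<circ> inv_into U \<phi>) has_derivative frechet_derivative (f \<circ> inv_into U \<phi>) (at (\<phi> x))) (at (\<phi> x))"
proof -
  obtain W where "x \<in> W" "smooth_fun_on M W f" using assms by (auto simp: smooth_near_def)
  then show ?thesis
    using smooth_on_has_derivative[OF smooth_fun_on_chart] assms(2) by blast
qed

lemma coord_vec_apply:
  "smooth_near M x f \<Longrightarrow>
    coord_vec M (U, \<phi>) b x f = frechet_derivative (f \<circ> inv_into U \<phi>) (at (\<phi> x)) b"
  by (simp add: coord_vec_def)

lemma linear_coord_vec:
  assumes "x \<in> U"
  shows "linear (\<lambda>b. coord_vec M (U, \<phi>) b x f)"
proof (cases "smooth_near M x f")
  case True
  then show ?thesis
    using has_derivative_linear[OF smooth_near_has_derivative[OF True assms]]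
    by (simp add: coord_vec_def)
next
  case False
  then show ?thesis by (simp add: coord_vec_def linear_zero)
qed

text \<open>The chain rule, applied to \<open>f \<circ> \<gamma> = (f \<circ> \<phi>\<^sup>-\<^sup>1) \<circ> (\<phi> \<circ> \<gamma>)\<close>.  Only differentiability of the curve at
  one instant is used, because integral curves are merely required to be differentiable.\<close>

lemma velocity_eq_coord_vec:
  assumes I: "open I" "t \<in> I" and \<gamma>: "continuous_map (top_of_set I) (mtop M) \<gamma>" "\<gamma> t \<in> U"
    and d: "((\<phi> \<circ> \<gamma>) has_vector_derivative b) (at t)"
  shows "velocity M \<gamma> t = coord_vec M (U, \<phi>) b (\<gamma> t)"
proof (rule ext)
  fix f
  show "velocity M \<gamma> t f = coord_vec M (U, \<phi>) b (\<gamma> t) f"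
  proof (cases "smooth_near M (\<gamma> t) f")
    case True
    let ?f = "f \<circ> inv_into U \<phi>"
    have "openin (top_of_set I) {s \<in> I. \<gamma> s \<in> U}"
      using openin_continuous_map_preimage[OF \<gamma>(1) openin_chart_domain] by simp
    then have N: "open {s \<in> I. \<gamma> s \<in> U}" using I(1) openin_open_eq by blast
    have "(?f has_derivative frechet_derivative ?f (at (\<phi> (\<gamma> t)))) (at ((\<phi> \<circ> \<gamma>) t))"
      using smooth_near_has_derivative[OF True \<gamma>(2)] by simp
    from diff_chain_at[OF d[unfolded has_vector_derivative_def] this]
    have "((\<lambda>s. ?f ((\<phi> \<circ> \<gamma>) s)) has_derivative (\<lambda>r. frechet_derivative ?f (at (\<phi> (\<gamma> t))) (r *\<^sub>R b))) (at t)"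
      by (simp only: o_def)
    then have "((f \<circ> \<gamma>) has_derivative (\<lambda>r. frechet_derivative ?f (at (\<phi> (\<gamma> t))) (r *\<^sub>R b))) (at t)"
      by (rule has_derivative_transform_within_open[OF _ N]) (use I \<gamma> in auto)
    moreover have "frechet_derivative ?f (at (\<phi> (\<gamma> t))) (r *\<^sub>R b)
        = frechet_derivative ?f (at (\<phi> (\<gamma> t))) b * r" for r
      using has_derivative_linear[OF smooth_near_has_derivative[OF True \<gamma>(2)]]
      by (simp add: linear_scale)
    ultimately have "((f \<circ> \<gamma>) has_real_derivative frechet_derivative ?f (at (\<phi> (\<gamma> t))) b) (at t)"
      by (simp add: has_field_derivative_def)
    then show ?thesis
      using True by (simp add: velocity_def coord_vec_apply DERIV_imp_deriv)
  next
    case False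
    then show ?thesis by (simp add: velocity_def coord_vec_def)
  qed
qed

lemma smooth_fun_on_coordinate:
  fixes L :: "'e \<Rightarrow> real"
  assumes "bounded_linear L"
  shows "smooth_fun_on M U (\<lambda>x. L (\<phi> x))"
  unfolding smooth_fun_on_def
proof (clarify)
  fix V \<psi> assume c: "(V, \<psi>) \<in> atlas M"
  have "open (\<psi> ` (V \<inter> U))"
    using smooth_atlas.open_chart_image_Int[OF smooth_atlas_axioms c openin_chart_domain] .
  moreover have "smooth_on (\<psi> ` (V \<inter> U)) (\<phi> \<circ> inv_into V \<psi>)"
    using compat[OF c chart] by (simp add: compatible_def)
  ultimately show "smooth_on (\<psi> ` (V \<inter> U)) ((\<lambda>x. L (\<phi> x)) \<circ> inv_into V \<psi>)"
    using smooth_on_compose[of _ "\<phi> \<circ> inv_into V \<psi>" UNIV L] smooth_on_linear[OF assms]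
    by (simp add: o_def)
qed

lemma smooth_near_coordinate:
  fixes L :: "'e \<Rightarrow> real"
  assumes "bounded_linear L" "x \<in> U"
  shows "smooth_near M x (\<lambda>x. L (\<phi> x))"
  using smooth_fun_on_coordinate[OF assms(1)] openin_chart_domain assms(2)
  by (auto simp: smooth_near_def)

text \<open>Applied to coordinate functions, a coordinate vector returns its own components, so its
  components can be read off from it.\<close>

lemma coord_vec_coordinate:
  fixes L :: "'e \<Rightarrow> real"
  assumes "bounded_linear L" "x \<in> U"
  shows "coord_vec M (U, \<phi>) b x (\<lambda>x. L (\<phi> x)) = L b"
proof -
  have "frechet_derivative ((\<lambda>x. L (\<phi> x)) \<circ> inv_into U \<phi>) (at (\<phi> x)) = L"
    using assms
    by (intro frechet_derivative_cong_open[OF open_chart_image _ _ bounded_linear_imp_has_derivative])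
      (auto)
  then show ?thesis using smooth_near_coordinate[OF assms] by (simp add: coord_vec_apply)
qed

lemma coord_vec_inject:
  assumes "x \<in> U" "coord_vec M (U, \<phi>) b x = coord_vec M (U, \<phi>) b' x"
  shows "b = b'"
proof (rule euclidean_eqI)
  fix i :: 'e
  show "b \<bullet> i = b' \<bullet> i"
    using coord_vec_coordinate[OF bounded_linear_inner_left assms(1), of b i]
      coord_vec_coordinate[OF bounded_linear_inner_left assms(1), of b' i] assms(2)
    by simp
qed

text \<open>The vector is the velocity of the curve that is a straight line in the chart.\<close>

lemma coord_vec_in_tangent_space:
  assumes x: "x \<in> U"
  shows "coord_vec M (U, \<phi>) b x \<in> tangent_space M x"
proof -
  define line where "line s = \<phi> x + s *\<^sub>R b" for s :: real
  define \<gamma> where "\<gamma> = inv_into U \<phi> \<circ> line"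
  have cont: "continuous_on S line" for S
    unfolding line_def by (intro continuous_intros)
  have "open (line -` (\<phi> ` U))"
    using cont open_chart_image by (metis continuous_on_open_vimage open_UNIV Int_UNIV_right)
  moreover have "0 \<in> line -` (\<phi> ` U)" using x by (simp add: line_def)
  ultimately obtain e where e: "e > 0" "ball 0 e \<subseteq> line -` (\<phi> ` U)" using openE by blast
  define I where "I = {-e<..<e}"
  have I: "open I" "0 \<in> I" using e by (auto simp: I_def)
  have line_in: "line ` I \<subseteq> \<phi> ` U"
    using e(2) by (auto simp: I_def image_subset_iff_subset_vimage subset_iff dist_real_def)
  have "continuous_map (top_of_set I) (top_of_set (\<phi> ` U)) line"
    using cont line_in by (simp add: image_subset_iff_funcset)
  then have \<gamma>: "continuous_map (top_of_set I) (mtop M) \<gamma>"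
    unfolding \<gamma>_def by (rule continuous_map_compose[OF _ continuous_map_inv_chart])
  have smooth_line: "smooth_on S line" if "open S" for S
    unfolding line_def
    by (intro smooth_on_add that smooth_on_const smooth_on_linear bounded_linear_scaleR_left)
  have "smooth_curve M I \<gamma>"
    unfolding smooth_curve_def
  proof (intro conjI \<gamma>, clarify)
    fix V \<psi> assume c: "(V, \<psi>) \<in> atlas M"
    have oV: "openin (mtop M) V"
      using charts[OF c] by (simp add: is_chart_def)
    have "openin (top_of_set I) {t \<in> I. \<gamma> t \<in> V}"
      using openin_continuous_map_preimage[OF \<gamma> oV] by simp
    then have N: "open {t \<in> I. \<gamma> t \<in> V}" using I(1) openin_open_eq by blast
    have "line ` {t \<in> I. \<gamma> t \<in> V} \<subseteq> \<phi> ` (U \<inter> V)"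
      using line_in by (fastforce simp: \<gamma>_def)
    then have "smooth_on {t \<in> I. \<gamma> t \<in> V} (\<lambda>t. (\<psi> \<circ> inv_into U \<phi>) (line t))"
      by (rule smooth_on_compose[OF N _ smooth_line[OF N] smooth_transition[OF c]])
    then show "smooth_on {t \<in> I. \<gamma> t \<in> V} (\<psi> \<circ> \<gamma>)" by (simp add: \<gamma>_def o_def)
  qed
  moreover have "\<gamma> 0 = x" using x by (simp add: \<gamma>_def line_def)
  moreover have "velocity M \<gamma> 0 = coord_vec M (U, \<phi>) b (\<gamma> 0)"
  proof (rule velocity_eq_coord_vec[OF I \<gamma>])
    show "\<gamma> 0 \<in> U" using x \<open>\<gamma> 0 = x\<close> by simp
    have "(line has_vector_derivative b) (at 0)"
      unfolding line_def has_vector_derivative_def by (auto intro!: derivative_eq_intros)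
    then show "((\<phi> \<circ> \<gamma>) has_vector_derivative b) (at 0)"
      unfolding has_vector_derivative_def
      by (rule has_derivative_transform_within_open[OF _ I])
        (use line_in in \<open>auto simp: \<gamma>_def f_inv_into_f\<close>)
  qed
  ultimately show ?thesis
    using e(1) unfolding tangent_space_def I_def
    by (intro CollectI exI[of _ \<gamma>] exI[of _ e]) simp
qed

lemma tangent_space_eq:
  assumes "x \<in> U"
  shows "tangent_space M x = range (\<lambda>b. coord_vec M (U, \<phi>) b x)"
proof
  show "range (\<lambda>b. coord_vec M (U, \<phi>) b x) \<subseteq> tangent_space M x"
    using coord_vec_in_tangent_space[OF assms] by blast
  show "tangent_space M x \<subseteq> range (\<lambda>b. coord_vec M (U, \<phi>) b x)"
  proof
    fix v assume "v \<in> tangent_space M x"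
    then obtain \<gamma> e where v: "v = velocity M \<gamma> 0" "e > 0" "smooth_curve M {-e<..<e} \<gamma>" "\<gamma> 0 = x"
      by (auto simp: tangent_space_def)
    have "smooth_on {t \<in> {-e<..<e}. \<gamma> t \<in> U} (\<phi> \<circ> \<gamma>)"
      using v(3) chart by (auto simp: smooth_curve_def)
    then have "(\<phi> \<circ> \<gamma>) differentiable (at 0)"
      using v assms smooth_on_has_derivative[of "{t \<in> {-e<..<e}. \<gamma> t \<in> U}" "\<phi> \<circ> \<gamma>" 0]
      by (auto simp: differentiable_def)
    then have "((\<phi> \<circ> \<gamma>) has_vector_derivative vector_derivative (\<phi> \<circ> \<gamma>) (at 0)) (at 0)"
      using vector_derivative_works by blast
    then show "v \<in> range (\<lambda>b. coord_vec M (U, \<phi>) b x)"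
      using velocity_eq_coord_vec[of "{-e<..<e}" 0 \<gamma>] v assms by (auto simp: smooth_curve_def)
  qed
qed

text \<open>The Jacobian of the transition map transforms the components of a tangent vector: this is
  the chain rule for \<open>f \<circ> \<phi>\<^sup>-\<^sup>1 = (f \<circ> \<psi>\<^sup>-\<^sup>1) \<circ> (\<psi> \<circ> \<phi>\<^sup>-\<^sup>1)\<close>.\<close>

lemma coord_vec_change:
  assumes c': "(V, \<psi>) \<in> atlas M" and x: "x \<in> U" "x \<in> V"
  shows "coord_vec M (U, \<phi>) b x
    = coord_vec M (V, \<psi>) (frechet_derivative (\<psi> \<circ> inv_into U \<phi>) (at (\<phi> x)) b) x"
proof (rule ext)
  fix f
  show "coord_vec M (U, \<phi>) b x f
    = coord_vec M (V, \<psi>) (frechet_derivative (\<psi> \<circ> inv_into U \<phi>) (at (\<phi> x)) b) x f"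
  proof (cases "smooth_near M x f")
    case True
    let ?f = "f \<circ> inv_into V \<psi>" and ?\<tau> = "\<psi> \<circ> inv_into U \<phi>"
    have oV: "openin (mtop M) V" using charts[OF c'] by (simp add: is_chart_def)
    have invV: "inv_into V \<psi> (\<psi> y) = y" if "y \<in> V" for y
      using smooth_atlas.inv_chart[OF smooth_atlas_axioms c' that] .
    have "(?\<tau> has_derivative frechet_derivative ?\<tau> (at (\<phi> x))) (at (\<phi> x))"
      using smooth_on_has_derivative[OF smooth_transition[OF c']] x by blast
    moreover have "(?f has_derivative frechet_derivative ?f (at (\<psi> x))) (at (?\<tau> (\<phi> x)))"
      using smooth_atlas.smooth_near_has_derivative[OF smooth_atlas_axioms c' True x(2)] x by simp
    ultimately have "((?f \<circ> ?\<tau>) has_derivative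
        (frechet_derivative ?f (at (\<psi> x)) \<circ> frechet_derivative ?\<tau> (at (\<phi> x)))) (at (\<phi> x))"
      by (rule diff_chain_at)
    then have "frechet_derivative (f \<circ> inv_into U \<phi>) (at (\<phi> x))
        = frechet_derivative ?f (at (\<psi> x)) \<circ> frechet_derivative ?\<tau> (at (\<phi> x))"
      by (rule frechet_derivative_cong_open[OF open_chart_image_Int[OF oV], rotated 2])
        (use x invV in auto)
    then show ?thesis
      using True by (simp add: coord_vec_def)
  qed (simp add: coord_vec_def)
qed

end

text \<open>Changing components from one chart to the other and back changes nothing, as the components
  of a tangent vector in a chart are unique.\<close>

lemma transition_derivative_inverse:
  assumes "(U, \<phi>) \<in> atlas M" "(V, \<psi>) \<in> atlas M" "x \<in> U" "x \<in> V"
  shows "frechet_derivative (\<psi> \<circ> inv_into U \<phi>) (at (\<phi> x))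
    (frechet_derivative (\<phi> \<circ> inv_into V \<psi>) (at (\<psi> x)) b) = b"
  using assms by (intro coord_vec_inject[OF assms(2,4)]) (simp flip: coord_vec_change)

text \<open>A field is a vector field as soon as its components in every chart depend smoothly on the
  coordinates: its value on \<open>f\<close> is then, in the chart, a sum of products of smooth functions.\<close>

lemma vector_fieldI:
  assumes W: "openin (mtop M) W"
    and X: "\<And>U \<phi>. (U, \<phi>) \<in> atlas M \<Longrightarrow> \<exists>B. smooth_on (\<phi> ` (U \<inter> W)) B \<and>
      (\<forall>x\<in>U \<inter> W. X x = coord_vec M (U, \<phi>) (B (\<phi> x)) x)"
  shows "vector_field M W X"
  unfolding vector_field_def
proof (intro conjI W ballI allI impI)
  fix x assume x: "x \<in> W"
  then have "x \<in> (\<Union>c\<in>atlas M. fst c)" using openin_subset[OF W] cover by blast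
  then obtain U \<phi> where c: "(U, \<phi>) \<in> atlas M" "x \<in> U" by auto
  then show "X x \<in> tangent_space M x"
    using X[OF c(1)] x coord_vec_in_tangent_space[OF c] by auto
next
  fix V f assume V: "openin (mtop M) V \<and> V \<subseteq> W \<and> smooth_fun_on M V f"
  show "smooth_fun_on M V (\<lambda>x. X x f)"
    unfolding smooth_fun_on_def
  proof clarify
    fix U \<phi> assume c: "(U, \<phi>) \<in> atlas M"
    obtain B where B: "smooth_on (\<phi> ` (U \<inter> W)) B"
      "\<And>x. x \<in> U \<inter> W \<Longrightarrow> X x = coord_vec M (U, \<phi>) (B (\<phi> x)) x"
      using X[OF c] by auto
    let ?S = "\<phi> ` (U \<inter> V)" and ?f = "f \<circ> inv_into U \<phi>"
    have S: "open ?S" using open_chart_image_Int[OF c] V by blast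
    have f: "smooth_on ?S ?f" using smooth_fun_on_chart[OF c] V by blast
    have B': "smooth_on ?S B" using V by (intro smooth_on_subset[OF B(1)]) auto
    have "smooth_on ?S (\<lambda>z. \<Sum>i\<in>Basis. (B z \<bullet> i) * frechet_derivative ?f (at z) i)"
      by (intro smooth_on_sum S smooth_on_mult smooth_on_inner B' smooth_on_const
          smooth_on_frechet_derivative f)
    then show "smooth_on ?S ((\<lambda>x. X x f) \<circ> inv_into U \<phi>)"
    proof (rule smooth_on_cong[OF S, rotated])
      fix z assume "z \<in> ?S"
      then obtain x where x: "x \<in> U" "x \<in> V" "z = \<phi> x" by auto
      have near: "smooth_near M x f" using V x by (auto simp: smooth_near_def)
      have lin: "linear (frechet_derivative ?f (at z))"
        using has_derivative_linear[OF smooth_on_has_derivative[OF f]] x by blast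
      have "frechet_derivative ?f (at z) (B z) = (\<Sum>i\<in>Basis. (B z \<bullet> i) * frechet_derivative ?f (at z) i)"
        using linear_sum[OF lin, of "\<lambda>i. (B z \<bullet> i) *\<^sub>R i" Basis]
        by (simp add: euclidean_representation linear_scale[OF lin])
      then show "(\<Sum>i\<in>Basis. (B z \<bullet> i) * frechet_derivative ?f (at z) i)
          = ((\<lambda>x. X x f) \<circ> inv_into U \<phi>) z"
        using x V B(2)[of x] near by (auto simp: coord_vec_def inv_chart[OF c])
    qed
  qed
qed

end

lemma smooth_manifold_imp_smooth_atlas: "smooth_manifold M \<Longrightarrow> smooth_atlas M"
  by (simp add: smooth_manifold_def smooth_atlas_def)

section \<open>The cotangent bundle as a smooth atlas\<close>

definition bundle_coord ::
  "('a, real^'n) manifold \<Rightarrow> ('a, real^'n) chart \<Rightarrow> 'a cotangent \<Rightarrow> (real^'n) \<times> (real^'n)" where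
  "bundle_coord M c = snd (induced_chart M c)"

lemma induced_chart_eq: "induced_chart M (U, \<phi>) = (cotangent_over M U, bundle_coord M (U, \<phi>))"
  by (simp add: bundle_coord_def induced_chart_def)

lemma bundle_coord_apply:
  "bundle_coord M (U, \<phi>) (x, \<alpha>) = (\<phi> x, \<chi> i. \<alpha> (coord_vec M (U, \<phi>) (axis i 1) x))"
  by (simp add: bundle_coord_def induced_chart_def)

lemma xcoord_eq: "xcoord M c i = (\<lambda>u. fst (bundle_coord M c u) $ i)"
  and pcoord_eq: "pcoord M c i = (\<lambda>u. snd (bundle_coord M c u) $ i)"
  by (auto simp: xcoord_def pcoord_def bundle_coord_def)

lemma in_cotangent_over: "(x, \<alpha>) \<in> cotangent_over M U \<longleftrightarrow> x \<in> U \<and> \<alpha> \<in> cotangent_space M x"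
  by (simp add: cotangent_over_def)

text \<open>The covector at \<open>x\<close> with momenta \<open>p\<close>.  The component of a tangent vector along
  $\partial/\partial x^i$ is its value on the \<open>i\<close>-th coordinate function, which gives a formula
  without a choice of representatives.\<close>

definition covec ::
  "('a, real^'n) manifold \<Rightarrow> ('a, real^'n) chart \<Rightarrow> 'a \<Rightarrow> real^'n \<Rightarrow> 'a tvec \<Rightarrow> real" where
  "covec M c x p = (\<lambda>v. if v \<in> tangent_space M x then \<Sum>i\<in>UNIV. p $ i * v (\<lambda>y. snd c y $ i) else 0)"

locale cotangent_atlas = smooth_atlas M for M :: "('a, real^'n) manifold"
begin

context
  fixes U :: "'a set" and \<phi> :: "'a \<Rightarrow> real^'n"
  assumes chart: "(U, \<phi>) \<in> atlas M"
begin

lemma covec_coord_vec: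
  assumes "x \<in> U"
  shows "covec M (U, \<phi>) x p (coord_vec M (U, \<phi>) b x) = p \<bullet> b"
proof -
  have "coord_vec M (U, \<phi>) b x (\<lambda>y. \<phi> y $ i) = b $ i" for i
    using coord_vec_coordinate[OF chart bounded_linear_vec_nth assms] .
  then show ?thesis
    using coord_vec_in_tangent_space[OF chart assms] by (simp add: covec_def inner_vec_def)
qed

lemma coord_vec_add:
  "x \<in> U \<Longrightarrow> (\<lambda>f. coord_vec M (U, \<phi>) b x f + coord_vec M (U, \<phi>) b' x f) = coord_vec M (U, \<phi>) (b + b') x"
  by (intro ext) (simp add: linear_add[OF linear_coord_vec[OF chart]])

lemma coord_vec_scale:
  "x \<in> U \<Longrightarrow> (\<lambda>f. r * coord_vec M (U, \<phi>) b x f) = coord_vec M (U, \<phi>) (r *\<^sub>R b) x"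
  by (intro ext) (simp add: linear_scale[OF linear_coord_vec[OF chart]])

lemma covec_in_cotangent_space:
  assumes x: "x \<in> U"
  shows "covec M (U, \<phi>) x p \<in> cotangent_space M x"
  unfolding cotangent_space_def
proof (intro CollectI conjI ballI allI impI)
  fix v assume "v \<in> tangent_space M x"
  then obtain a where v: "v = coord_vec M (U, \<phi>) a x" using tangent_space_eq[OF chart x] by auto
  show "covec M (U, \<phi>) x p (\<lambda>f. r * v f) = r * covec M (U, \<phi>) x p v" for r
    unfolding v coord_vec_scale[OF x] covec_coord_vec[OF x] by simp
  fix w assume "w \<in> tangent_space M x"
  then obtain b where w: "w = coord_vec M (U, \<phi>) b x" using tangent_space_eq[OF chart x] by auto
  show "covec M (U, \<phi>) x p (\<lambda>f. v f + w f) = covec M (U, \<phi>) x p v + covec M (U, \<phi>) x p w"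
    unfolding v w coord_vec_add[OF x] covec_coord_vec[OF x] by (rule inner_add_right)
qed (simp add: covec_def)

text \<open>Covectors are linear and the vectors $\partial/\partial x^i$ span the tangent space, so a
  covector is determined by its momenta $p_i$.\<close>

lemma covector_coord_vec:
  assumes x: "x \<in> U" and \<alpha>: "\<alpha> \<in> cotangent_space M x"
  shows "\<alpha> (coord_vec M (U, \<phi>) b x) = snd (bundle_coord M (U, \<phi>) (x, \<alpha>)) \<bullet> b"
proof -
  let ?c = "\<lambda>b. coord_vec M (U, \<phi>) b x"
  have t: "?c b \<in> tangent_space M x" for b using coord_vec_in_tangent_space[OF chart x] .
  have lin: "linear (\<lambda>b. \<alpha> (?c b))"
  proof (rule linearI)
    show "\<alpha> (?c (a + b)) = \<alpha> (?c a) + \<alpha> (?c b)" for a b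
      using \<alpha> t[of a] t[of b] unfolding cotangent_space_def coord_vec_add[OF x, symmetric] by blast
    show "\<alpha> (?c (r *\<^sub>R a)) = r *\<^sub>R \<alpha> (?c a)" for r a
      using \<alpha> t[of a] unfolding cotangent_space_def coord_vec_scale[OF x, symmetric] by simp
  qed
  have "\<alpha> (?c (\<Sum>i\<in>UNIV. b $ i *\<^sub>R axis i 1)) = (\<Sum>i\<in>UNIV. b $ i * \<alpha> (?c (axis i 1)))"
    using linear_sum[OF lin, of "\<lambda>i. b $ i *\<^sub>R axis i 1" UNIV] linear_scale[OF lin] by simp
  then show ?thesis
    by (simp add: sum_axis bundle_coord_apply inner_vec_def mult.commute)
qed

lemma covec_bundle_coord:
  assumes x: "x \<in> U" and \<alpha>: "\<alpha> \<in> cotangent_space M x"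
  shows "covec M (U, \<phi>) x (snd (bundle_coord M (U, \<phi>) (x, \<alpha>))) = \<alpha>"
proof (rule ext)
  fix v
  show "covec M (U, \<phi>) x (snd (bundle_coord M (U, \<phi>) (x, \<alpha>))) v = \<alpha> v"
  proof (cases "v \<in> tangent_space M x")
    case True
    then obtain b where "v = coord_vec M (U, \<phi>) b x" using tangent_space_eq[OF chart x] by auto
    then show ?thesis using covec_coord_vec[OF x] covector_coord_vec[OF x \<alpha>] by simp
  next
    case False
    then show ?thesis using \<alpha> by (simp add: covec_def cotangent_space_def)
  qed
qed

lemma bundle_coord_covec:
  "x \<in> U \<Longrightarrow> bundle_coord M (U, \<phi>) (x, covec M (U, \<phi>) x p) = (\<phi> x, p)"
  by (simp add: bundle_coord_apply covec_coord_vec inner_axis vec_eq_iff)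

lemma inj_on_bundle_coord: "inj_on (bundle_coord M (U, \<phi>)) (cotangent_over M U)"
proof (rule inj_onI, clarify)
  fix x \<alpha> y \<beta>
  assume *: "(x, \<alpha>) \<in> cotangent_over M U" "(y, \<beta>) \<in> cotangent_over M U"
    and eq: "bundle_coord M (U, \<phi>) (x, \<alpha>) = bundle_coord M (U, \<phi>) (y, \<beta>)"
  then have "\<phi> x = \<phi> y" by (simp add: bundle_coord_apply)
  moreover have mem: "x \<in> U" "y \<in> U" "\<alpha> \<in> cotangent_space M x" "\<beta> \<in> cotangent_space M y"
    using * by (simp_all add: in_cotangent_over)
  ultimately have "x = y" using inj_onD[OF inj_on_chart[OF chart]] by blast
  moreover have "\<alpha> = \<beta>"
    using covec_bundle_coord[OF mem(1,3)] covec_bundle_coord[OF mem(2,4)] eq \<open>x = y\<close>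
    by metis
  ultimately show "x = y \<and> \<alpha> = \<beta>" by simp
qed

lemma inv_bundle_coord:
  assumes "y \<in> \<phi> ` U"
  shows "inv_into (cotangent_over M U) (bundle_coord M (U, \<phi>)) (y, p)
    = (inv_into U \<phi> y, covec M (U, \<phi>) (inv_into U \<phi> y) p)"
proof (rule inv_into_f_eq[OF inj_on_bundle_coord])
  have x: "inv_into U \<phi> y \<in> U" using assms by (rule inv_into_into)
  then show "(inv_into U \<phi> y, covec M (U, \<phi>) (inv_into U \<phi> y) p) \<in> cotangent_over M U"
    by (simp add: in_cotangent_over covec_in_cotangent_space)
  show "bundle_coord M (U, \<phi>) (inv_into U \<phi> y, covec M (U, \<phi>) (inv_into U \<phi> y) p) = (y, p)"
    using x assms by (simp add: bundle_coord_covec f_inv_into_f)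
qed

lemma bundle_coord_image:
  "bundle_coord M (U, \<phi>) ` (cotangent_over M U \<inter> cotangent_over M V) = \<phi> ` (U \<inter> V) \<times> UNIV"
proof
  show "bundle_coord M (U, \<phi>) ` (cotangent_over M U \<inter> cotangent_over M V) \<subseteq> \<phi> ` (U \<inter> V) \<times> UNIV"
    by (auto simp: in_cotangent_over bundle_coord_apply)
  show "\<phi> ` (U \<inter> V) \<times> UNIV \<subseteq> bundle_coord M (U, \<phi>) ` (cotangent_over M U \<inter> cotangent_over M V)"
  proof clarify
    fix x p assume x: "x \<in> U" "x \<in> V"
    then have "(x, covec M (U, \<phi>) x p) \<in> cotangent_over M U \<inter> cotangent_over M V"
      by (simp add: in_cotangent_over covec_in_cotangent_space)
    then show "(\<phi> x, p) \<in> bundle_coord M (U, \<phi>) ` (cotangent_over M U \<inter> cotangent_over M V)"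
      using bundle_coord_covec[OF x(1)] by (metis image_eqI)
  qed
qed

lemma bundle_coord_domain_image: "bundle_coord M (U, \<phi>) ` cotangent_over M U = \<phi> ` U \<times> UNIV"
  using bundle_coord_image[of U] by simp

text \<open>Positions transform by the transition map of the base, momenta by the transposed inverse of
  its Jacobian.  The inverse appears as the Jacobian of the opposite transition map, so that no matrix
  has to be inverted and smoothness is immediate.\<close>

lemma bundle_transition:
  assumes c': "(V, \<psi>) \<in> atlas M" and y: "y \<in> \<phi> ` (U \<inter> V)"
  shows "(bundle_coord M (V, \<psi>) \<circ> inv_into (cotangent_over M U) (bundle_coord M (U, \<phi>))) (y, p)
    = ((\<psi> \<circ> inv_into U \<phi>) y,
       \<chi> j. p \<bullet> frechet_derivative (\<phi> \<circ> inv_into V \<psi>) (at ((\<psi> \<circ> inv_into U \<phi>) y)) (axis j 1))"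
proof -
  obtain x where x: "x \<in> U" "x \<in> V" "y = \<phi> x" using y by auto
  then show ?thesis
    using inv_bundle_coord[of y p]
    by (simp add: inv_chart[OF chart] bundle_coord_apply coord_vec_change[OF c' chart x(2,1)]
        covec_coord_vec[OF x(1)])
qed

lemma smooth_bundle_transition:
  assumes c': "(V, \<psi>) \<in> atlas M"
  shows "smooth_on (\<phi> ` (U \<inter> V) \<times> UNIV)
    (bundle_coord M (V, \<psi>) \<circ> inv_into (cotangent_over M U) (bundle_coord M (U, \<phi>)))"
proof -
  let ?S = "\<phi> ` (U \<inter> V) \<times> (UNIV :: (real^'n) set)"
  let ?\<tau> = "\<psi> \<circ> inv_into U \<phi>" and ?\<sigma> = "\<phi> \<circ> inv_into V \<psi>"
  have "openin (mtop M) V" using openin_chart_domain[OF c'] .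
  then have S: "open ?S" by (intro open_Times open_chart_image_Int[OF chart]) auto
  have \<tau>: "smooth_on ?S (\<lambda>z. ?\<tau> (fst z))"
    by (rule smooth_on_compose[OF S _ smooth_on_linear[OF bounded_linear_fst]
          smooth_transition[OF chart c']]) auto
  have im: "(\<lambda>z. ?\<tau> (fst z)) ` ?S \<subseteq> \<psi> ` (V \<inter> U)"
    using inv_chart[OF chart] by auto
  have "smooth_on ?S (\<lambda>z. frechet_derivative ?\<sigma> (at (?\<tau> (fst z))) b)" for b
    by (rule smooth_on_compose[OF S im \<tau> smooth_on_frechet_derivative[OF smooth_transition[OF c' chart]]])
  from smooth_on_inner[OF S smooth_on_linear[OF bounded_linear_snd] this]
  have "smooth_on ?S (\<lambda>z. (?\<tau> (fst z),
      \<chi> j. snd z \<bullet> frechet_derivative ?\<sigma> (at (?\<tau> (fst z))) (axis j 1)))"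
    by (intro smooth_on_Pair[OF S \<tau>] smooth_on_vec_lambda[OF S])
  then show ?thesis
    by (rule smooth_on_cong[OF S, rotated]) (auto simp: bundle_transition[OF c'] simp del: o_apply)
qed

lemma openin_bundle_coord_vimage:
  assumes "open V"
  shows "openin (mtop (cotangent_bundle M)) {u \<in> cotangent_over M U. bundle_coord M (U, \<phi>) u \<in> V}"
proof -
  have "{u \<in> fst (induced_chart M (U, \<phi>)). snd (induced_chart M (U, \<phi>)) u \<in> V}
      \<in> {{u \<in> fst (induced_chart M c). snd (induced_chart M c) u \<in> V} | c V. c \<in> atlas M \<and> open V}"
    using chart assms by blast
  then show ?thesis
    unfolding cotangent_bundle_def manifold.simps
    by (intro topology_generated_by_Basis) (simp add: induced_chart_eq)
qed

end

lemma topspace_cotangent_bundle: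
  "topspace (mtop (cotangent_bundle M)) = (\<Union>c\<in>atlas M. fst (induced_chart M c))"
proof -
  have "\<Union>{{u \<in> fst (induced_chart M c). snd (induced_chart M c) u \<in> V} | c V. c \<in> atlas M \<and> open V}
      = (\<Union>c\<in>atlas M. fst (induced_chart M c))" (is "\<Union>?A = ?B")
  proof
    show "\<Union>?A \<subseteq> ?B" by blast
    have "fst (induced_chart M c) \<in> ?A" if "c \<in> atlas M" for c
      using that by (intro CollectI exI[of _ c] exI[of _ UNIV]) simp
    then show "?B \<subseteq> \<Union>?A" by (intro UN_least Union_upper)
  qed
  then show ?thesis by (simp add: cotangent_bundle_def)
qed

text \<open>The topology of the bundle is generated by the preimages of open sets under all induced
  charts.  Pulling such a generator back through one chart gives a preimage under a transition
  map, and transition maps are continuous.\<close>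

lemma continuous_map_inv_bundle_coord:
  assumes chart: "(U, \<phi>) \<in> atlas M"
  shows "continuous_map (top_of_set (\<phi> ` U \<times> UNIV)) (mtop (cotangent_bundle M))
    (inv_into (cotangent_over M U) (bundle_coord M (U, \<phi>)))"
  (is "continuous_map (top_of_set ?S) _ ?g")
proof -
  have g: "?g z \<in> cotangent_over M U" "bundle_coord M (U, \<phi>) (?g z) = z" if "z \<in> ?S" for z
    using that bundle_coord_domain_image[OF chart]
    by (metis inv_into_into, metis f_inv_into_f)
  show ?thesis
  proof (subst cotangent_bundle_def, unfold manifold.simps, rule continuous_on_generated_topo)
    have "?g ` ?S \<subseteq> topspace (mtop (cotangent_bundle M))"
      unfolding topspace_cotangent_bundle using g(1) chart by (fastforce simp: induced_chart_eq)
    then show "?g ` topspace (top_of_set ?S)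
        \<subseteq> \<Union>{{u \<in> fst (induced_chart M c). snd (induced_chart M c) u \<in> O'} | c O'. c \<in> atlas M \<and> open O'}"
      by (simp add: cotangent_bundle_def)
  next
    fix W
    assume "W \<in> {{u \<in> fst (induced_chart M c). snd (induced_chart M c) u \<in> O'} | c O'. c \<in> atlas M \<and> open O'}"
    then obtain V \<psi> O' where c': "(V, \<psi>) \<in> atlas M" and O': "open O'"
      and W: "W = {u \<in> cotangent_over M V. bundle_coord M (V, \<psi>) u \<in> O'}"
      by (auto simp: induced_chart_eq)
    let ?T = "bundle_coord M (V, \<psi>) \<circ> ?g" and ?S' = "\<phi> ` (U \<inter> V) \<times> (UNIV :: (real^'n) set)"
    have S': "open ?S'"
      by (intro open_Times open_chart_image_Int[OF chart openin_chart_domain[OF c']]) auto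
    have "open (?T -` O' \<inter> ?S')"
      using smooth_on_continuous_on[OF smooth_bundle_transition[OF chart c']] S' O'
      using continuous_on_open_vimage by blast
    moreover have "?g -` W \<inter> topspace (top_of_set ?S) = ?T -` O' \<inter> ?S'"
    proof -
      have "?g z \<in> cotangent_over M V \<longleftrightarrow> z \<in> ?S'" if "z \<in> ?S" for z
      proof -
        have "z \<in> ?S' \<longleftrightarrow> z \<in> bundle_coord M (U, \<phi>) ` (cotangent_over M U \<inter> cotangent_over M V)"
          by (simp only: bundle_coord_image[OF chart])
        also have "\<dots> \<longleftrightarrow> ?g z \<in> cotangent_over M V"
          using g[OF that] inj_on_bundle_coord[OF chart] by (auto simp: inj_on_def intro: rev_image_eqI)
        finally show ?thesis by simp
      qed
      then show ?thesis using W by auto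
    qed
    ultimately show "openin (top_of_set ?S) (?g -` W \<inter> topspace (top_of_set ?S))"
      by (auto intro!: open_openin_trans simp: openin_open_eq[OF open_Times[OF open_chart_image[OF chart] open_UNIV]])
  qed
qed

lemma atlas_cotangent_bundle:
  "c \<in> atlas (cotangent_bundle M) \<longleftrightarrow>
    (\<exists>U \<phi>. (U, \<phi>) \<in> atlas M \<and> c = (cotangent_over M U, bundle_coord M (U, \<phi>)))"
  unfolding cotangent_bundle_def by (force simp flip: induced_chart_eq)

lemma is_chart_induced_chart:
  assumes chart: "(U, \<phi>) \<in> atlas M"
  shows "is_chart (mtop (cotangent_bundle M)) (cotangent_over M U, bundle_coord M (U, \<phi>))"
proof -
  let ?T = "mtop (cotangent_bundle M)" and ?U = "cotangent_over M U" and ?\<Phi> = "bundle_coord M (U, \<phi>)"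
  have U: "openin ?T ?U" using openin_bundle_coord_vimage[OF chart open_UNIV] by simp
  have im: "?\<Phi> ` ?U = \<phi> ` U \<times> UNIV" using bundle_coord_domain_image[OF chart] .
  have "open (?\<Phi> ` ?U)" unfolding im using open_chart_image[OF chart] by (simp add: open_Times)
  moreover have top: "topspace (subtopology ?T ?U) = ?U"
    using openin_subset[OF U] by (simp add: topspace_subtopology Int_absorb1)
  have "homeomorphic_maps (subtopology ?T ?U) (top_of_set (?\<Phi> ` ?U)) ?\<Phi> (inv_into ?U ?\<Phi>)"
    unfolding homeomorphic_maps_def
  proof (intro conjI ballI)
    have "continuous_map (subtopology ?T ?U) euclidean ?\<Phi>"
      unfolding continuous_map_def top
      using openin_bundle_coord_vimage[OF chart] U
      by (auto simp: openin_open_subtopology)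
    then show "continuous_map (subtopology ?T ?U) (top_of_set (?\<Phi> ` ?U)) ?\<Phi>"
      using top by (auto simp: continuous_map_in_subtopology)
    have "inv_into ?U ?\<Phi> z \<in> ?U" if "z \<in> ?\<Phi> ` ?U" for z using that by (rule inv_into_into)
    then show "continuous_map (top_of_set (?\<Phi> ` ?U)) (subtopology ?T ?U) (inv_into ?U ?\<Phi>)"
      using continuous_map_inv_bundle_coord[OF chart] im by (auto simp: continuous_map_in_subtopology)
    show "inv_into ?U ?\<Phi> (?\<Phi> u) = u" if "u \<in> topspace (subtopology ?T ?U)" for u
      using that unfolding top by (rule inv_into_f_f[OF inj_on_bundle_coord[OF chart]])
    show "?\<Phi> (inv_into ?U ?\<Phi> z) = z" if "z \<in> topspace (top_of_set (?\<Phi> ` ?U))" for z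
      using that by (simp add: f_inv_into_f)
  qed
  ultimately show ?thesis
    using U homeomorphic_map_maps by (auto simp: is_chart_def)
qed

lemma smooth_atlas_cotangent_bundle: "smooth_atlas (cotangent_bundle M)"
proof
  show "is_chart (mtop (cotangent_bundle M)) c" if "c \<in> atlas (cotangent_bundle M)" for c
    using that is_chart_induced_chart by (auto simp: atlas_cotangent_bundle)
  show "(\<Union>c\<in>atlas (cotangent_bundle M). fst c) = topspace (mtop (cotangent_bundle M))"
    unfolding topspace_cotangent_bundle by (simp add: cotangent_bundle_def)
  show "compatible c d" if cd: "c \<in> atlas (cotangent_bundle M)" "d \<in> atlas (cotangent_bundle M)" for c d
  proof -
    obtain U \<phi> V \<psi> where c: "(U, \<phi>) \<in> atlas M" "c = (cotangent_over M U, bundle_coord M (U, \<phi>))"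
      and d: "(V, \<psi>) \<in> atlas M" "d = (cotangent_over M V, bundle_coord M (V, \<psi>))"
      using cd unfolding atlas_cotangent_bundle by blast
    have "bundle_coord M (V, \<psi>) ` (cotangent_over M U \<inter> cotangent_over M V) = \<psi> ` (V \<inter> U) \<times> UNIV"
      using bundle_coord_image[OF d(1), of U] by (simp only: Int_commute)
    then show ?thesis
      using smooth_bundle_transition[OF c(1) d(1)] smooth_bundle_transition[OF d(1) c(1)]
      unfolding c(2) d(2) compatible_def prod.case bundle_coord_image[OF c(1)] by simp
  qed
qed

sublocale cot: smooth_atlas "cotangent_bundle M"
  by (rule smooth_atlas_cotangent_bundle)

lemma induced_chart_in_atlas:
  "(U, \<phi>) \<in> atlas M \<Longrightarrow> (cotangent_over M U, bundle_coord M (U, \<phi>)) \<in> atlas (cotangent_bundle M)"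
  by (auto simp: atlas_cotangent_bundle)

text \<open>The zero section is \<open>p = 0\<close> in every chart, which makes its complement open.\<close>

lemma slit_cotangent_iff:
  assumes chart: "(U, \<phi>) \<in> atlas M" and u: "u \<in> cotangent_over M U"
  shows "u \<in> slit_cotangent M \<longleftrightarrow> snd (bundle_coord M (U, \<phi>) u) \<noteq> 0"
proof -
  obtain x \<alpha> where u': "u = (x, \<alpha>)" "x \<in> U" "\<alpha> \<in> cotangent_space M x"
    using u by (cases u) (auto simp: in_cotangent_over)
  have "x \<in> topspace (mtop M)" using chart_domain_subset[OF chart] u' by blast
  moreover have "\<alpha> = (\<lambda>_. 0) \<longleftrightarrow> snd (bundle_coord M (U, \<phi>) u) = 0"
  proof
    assume "snd (bundle_coord M (U, \<phi>) u) = 0"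
    moreover have "covec M (U, \<phi>) x 0 = (\<lambda>_. 0)" by (simp add: covec_def fun_eq_iff)
    ultimately show "\<alpha> = (\<lambda>_. 0)"
      using covec_bundle_coord[OF chart u'(2,3)] u'(1) by simp
  qed (simp add: u' bundle_coord_apply vec_eq_iff)
  ultimately show ?thesis using u' by (simp add: slit_cotangent_def)
qed

lemma slit_cotangent_chart:
  assumes "u \<in> slit_cotangent M"
  obtains U \<phi> where "(U, \<phi>) \<in> atlas M" "u \<in> cotangent_over M U"
proof -
  from assms have "fst u \<in> (\<Union>c\<in>atlas M. fst c)" unfolding cover by (auto simp: slit_cotangent_def)
  then obtain U \<phi> where "(U, \<phi>) \<in> atlas M" "fst u \<in> U" by auto
  then show ?thesis
    using that[of U \<phi>] assms by (auto simp: slit_cotangent_def in_cotangent_over)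
qed

lemma openin_slit_cotangent: "openin (mtop (cotangent_bundle M)) (slit_cotangent M)"
proof -
  have "slit_cotangent M
      = (\<Union>(U, \<phi>)\<in>atlas M. {u \<in> cotangent_over M U. bundle_coord M (U, \<phi>) u \<in> UNIV \<times> (- {0})})"
    (is "_ = ?R")
  proof (intro equalityI subsetI)
    fix u assume u: "u \<in> slit_cotangent M"
    then obtain U \<phi> where "(U, \<phi>) \<in> atlas M" "u \<in> cotangent_over M U" by (rule slit_cotangent_chart)
    then show "u \<in> ?R" using slit_cotangent_iff u by (auto simp: mem_Times_iff)
  next
    fix u assume "u \<in> ?R"
    then obtain U \<phi> where "(U, \<phi>) \<in> atlas M" "u \<in> cotangent_over M U"
      "snd (bundle_coord M (U, \<phi>) u) \<noteq> 0" by force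
    then show "u \<in> slit_cotangent M" using slit_cotangent_iff by blast
  qed
  moreover have "openin (mtop (cotangent_bundle M))
      {u \<in> cotangent_over M U. bundle_coord M (U, \<phi>) u \<in> UNIV \<times> (- {0})}" if "(U, \<phi>) \<in> atlas M" for U \<phi>
    by (intro openin_bundle_coord_vimage[OF that] open_Times) auto
  ultimately show ?thesis by auto
qed

end

section \<open>Invariance of the symplectic form\<close>

text \<open>The canonical form $\sum_i dx^i \wedge dp_i$ of position and momentum components.\<close>

definition symplectic_form :: "'b::real_inner \<times> 'b \<Rightarrow> 'b \<times> 'b \<Rightarrow> real" where
  "symplectic_form w w' = fst w \<bullet> snd w' - snd w \<bullet> fst w'"

lemma symplectic_form_nondegenerate:
  assumes "\<And>w. symplectic_form u w = symplectic_form v w"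
  shows "u = v"
proof -
  define d where "d = u - v"
  have "symplectic_form d (- snd d, fst d) = 0"
    using assms[of "(- snd d, fst d)"] by (simp add: d_def symplectic_form_def algebra_simps)
  then have "(norm (fst d))\<^sup>2 + (norm (snd d))\<^sup>2 = 0"
    by (simp add: symplectic_form_def power2_norm_eq_inner)
  then have "d = 0" by (simp add: prod_eq_iff sum_power2_eq_zero_iff)
  then show ?thesis by (simp add: d_def)
qed

context cotangent_atlas
begin

text \<open>Both sides are the value of one covector on one tangent vector, computed in two charts.
  This is the invariance of the Liouville form $p_i\,dx^i$.\<close>

lemma bundle_transition_covariant:
  assumes "(U, \<phi>) \<in> atlas M" "(V, \<psi>) \<in> atlas M" "y \<in> \<phi> ` (U \<inter> V)"
  shows "snd ((bundle_coord M (V, \<psi>) \<circ> inv_into (cotangent_over M U) (bundle_coord M (U, \<phi>))) (y, p))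
      \<bullet> frechet_derivative (\<psi> \<circ> inv_into U \<phi>) (at y) v = p \<bullet> v"
proof -
  obtain x where x: "x \<in> U" "x \<in> V" "y = \<phi> x" using assms(3) by auto
  let ?\<alpha> = "covec M (U, \<phi>) x p"
  have \<alpha>: "?\<alpha> \<in> cotangent_space M x" using covec_in_cotangent_space[OF assms(1) x(1)] .
  have "p \<bullet> v = ?\<alpha> (coord_vec M (U, \<phi>) v x)" using covec_coord_vec[OF assms(1) x(1)] by simp
  also have "\<dots> = ?\<alpha> (coord_vec M (V, \<psi>) (frechet_derivative (\<psi> \<circ> inv_into U \<phi>) (at y) v) x)"
    using coord_vec_change[OF assms(1,2) x(1,2)] x(3) by simp
  also have "\<dots> = snd (bundle_coord M (V, \<psi>) (x, ?\<alpha>)) \<bullet> frechet_derivative (\<psi> \<circ> inv_into U \<phi>) (at y) v"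
    by (rule covector_coord_vec[OF assms(2) x(2) \<alpha>])
  finally show ?thesis
    using x inv_bundle_coord[OF assms(1), of y p] by (simp add: inv_chart[OF assms(1)])
qed

text \<open>Write \<open>P\<close> for the momenta after the transition and \<open>\<tau>\<close> for the transition map of the base.
  Differentiating \<open>P \<bullet> D\<tau>(v) = p \<bullet> v\<close> in the direction \<open>w\<close> expresses \<open>DP(w) \<bullet> D\<tau>(v)\<close> as
  \<open>snd w \<bullet> v - P \<bullet> D\<^sup>2\<tau>(fst w, v)\<close>.  In the antisymmetric form the second derivatives of \<open>\<tau>\<close> cancel
  by their symmetry.\<close>

lemma symplectic_form_invariant:
  assumes c: "(U, \<phi>) \<in> atlas M" and c': "(V, \<psi>) \<in> atlas M" and z: "z \<in> \<phi> ` (U \<inter> V) \<times> UNIV"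
  defines "T \<equiv> bundle_coord M (V, \<psi>) \<circ> inv_into (cotangent_over M U) (bundle_coord M (U, \<phi>))"
  shows "symplectic_form (frechet_derivative T (at z) w) (frechet_derivative T (at z) w') = symplectic_form w w'"
proof -
  let ?N = "\<phi> ` (U \<inter> V)" and ?\<tau> = "\<psi> \<circ> inv_into U \<phi>"
  let ?D = "\<lambda>y. frechet_derivative ?\<tau> (at y)" and ?DT = "frechet_derivative T (at z)"
  let ?E = "\<lambda>v. frechet_derivative (\<lambda>y. ?D y v) (at (fst z))"
  have N: "open ?N" using open_chart_image_Int[OF c openin_chart_domain[OF c']] .
  have S: "open (?N \<times> (UNIV :: (real^'n) set))" using N by (simp add: open_Times)
  have y: "fst z \<in> ?N" using z by auto
  have smooth: "smooth_on ?N ?\<tau>" using smooth_transition[OF c c'] .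
  have dT: "(T has_derivative ?DT) (at z)"
    unfolding T_def by (rule smooth_on_has_derivative[OF smooth_bundle_transition[OF c c'] z])
  have dfst: "((\<lambda>z. g (fst z)) has_derivative (\<lambda>w. g' (fst w))) (at z)"
    if "(g has_derivative g') (at (fst z))" for g :: "real^'n \<Rightarrow> real^'n" and g'
    using diff_chain_at[OF bounded_linear_imp_has_derivative[OF bounded_linear_fst], of g g' z] that
    by (simp add: o_def)
  have fst_DT: "fst (?DT w) = ?D (fst z) (fst w)" for w
  proof -
    have "((\<lambda>z. fst (T z)) has_derivative (\<lambda>w. ?D (fst z) (fst w))) (at z)"
    proof (rule has_derivative_transform_within_open[OF dfst[OF smooth_on_has_derivative[OF smooth y]] S z])
      show "?\<tau> (fst u) = fst (T u)" if "u \<in> ?N \<times> UNIV" for u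
        using that bundle_transition[OF c c', of "fst u" "snd u"] unfolding T_def
        by (simp add: mem_Times_iff del: o_apply)
    qed
    from has_derivative_unique[OF this has_derivative_fst[OF dT]] show ?thesis by metis
  qed
  have key: "snd (?DT w) \<bullet> ?D (fst z) v = snd w \<bullet> v - snd (T z) \<bullet> ?E v (fst w)" for w v
  proof -
    have "((\<lambda>y. ?D y v) has_derivative ?E v) (at (fst z))"
      by (rule smooth_on_has_derivative[OF smooth_on_frechet_derivative[OF smooth] y])
    from has_derivative_inner[OF has_derivative_snd[OF dT] dfst[OF this]]
    have d1: "((\<lambda>z. snd z \<bullet> v) has_derivative
        (\<lambda>w. snd (T z) \<bullet> ?E v (fst w) + snd (?DT w) \<bullet> ?D (fst z) v)) (at z)"
    proof (rule has_derivative_transform_within_open[OF _ S z])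
      show "snd (T u) \<bullet> ?D (fst u) v = snd u \<bullet> v" if "u \<in> ?N \<times> UNIV" for u
      proof -
        obtain y p where u: "u = (y, p)" "y \<in> ?N" using \<open>u \<in> ?N \<times> UNIV\<close> by blast
        show ?thesis
          unfolding u(1) T_def fst_conv snd_conv by (rule bundle_transition_covariant[OF c c' u(2)])
      qed
    qed
    have d2: "((\<lambda>z. snd z \<bullet> v) has_derivative (\<lambda>w. snd w \<bullet> v)) (at z)"
      by (intro has_derivative_inner_left has_derivative_snd has_derivative_ident)
    from fun_cong[OF has_derivative_unique[OF d2 d1], of w] show ?thesis by simp
  qed
  have sym: "?E v a = ?E a v" for a v
    by (rule smooth_on_second_derivative_symmetric[OF N smooth y])
  show ?thesis
    unfolding symplectic_form_def fst_DT
    by (simp only: key inner_commute[of "?D (fst z) _" "snd _"] sym[of "fst w" "fst w'"])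
      (simp add: inner_commute)
qed

section \<open>Hamiltonian vector fields\<close>

lemma coord_vec_bundle_expand:
  assumes c: "(U, \<phi>) \<in> atlas M" and u: "u \<in> cotangent_over M U"
  shows "coord_vec (cotangent_bundle M) (cotangent_over M U, bundle_coord M (U, \<phi>)) w u f
    = (\<Sum>i\<in>UNIV. fst w $ i * dx M (U, \<phi>) i u f + snd w $ i * dp M (U, \<phi>) i u f)"
proof -
  let ?c = "\<lambda>w. coord_vec (cotangent_bundle M) (cotangent_over M U, bundle_coord M (U, \<phi>)) w u f"
  have lin: "linear ?c" using cot.linear_coord_vec[OF induced_chart_in_atlas[OF c] u] .
  have "(\<Sum>i\<in>UNIV. (fst w $ i) *\<^sub>R (axis i 1, 0) + (snd w $ i) *\<^sub>R (0, axis i 1)) = w"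
    by (simp add: prod_eq_iff fst_sum snd_sum sum_axis)
  then have "?c w = ?c (\<Sum>i\<in>UNIV. (fst w $ i) *\<^sub>R (axis i 1, 0) + (snd w $ i) *\<^sub>R (0, axis i 1))"
    by (simp only:)
  also have "\<dots> = (\<Sum>i\<in>UNIV. fst w $ i * ?c (axis i 1, 0) + snd w $ i * ?c (0, axis i 1))"
    by (simp only: linear_sum[OF lin] linear_add[OF lin] linear_scale[OF lin] real_scaleR_def)
  finally show ?thesis by (simp add: dx_def dp_def induced_chart_eq)
qed

text \<open>The components of the Hamiltonian vector field
  $\frac{\partial H}{\partial p_i}\frac{\partial}{\partial x^i}
   - \frac{\partial H}{\partial x^i}\frac{\partial}{\partial p_i}$.\<close>

definition ham_vec :: "('a cotangent \<Rightarrow> real) \<Rightarrow> ('a, real^'n) chart \<Rightarrow> 'a cotangent \<Rightarrow> (real^'n) \<times> (real^'n)" where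
  "ham_vec H c u = (\<chi> i. dp M c i u H, \<chi> i. - dx M c i u H)"

text \<open>The property that characterises the Hamiltonian vector field: paired with \<open>w\<close> by the
  symplectic form, it gives the differential of \<open>H\<close> at \<open>w\<close>.\<close>

lemma symplectic_form_ham_vec:
  assumes c: "(U, \<phi>) \<in> atlas M" and u: "u \<in> cotangent_over M U"
  shows "symplectic_form (ham_vec H (U, \<phi>) u) w
    = coord_vec (cotangent_bundle M) (cotangent_over M U, bundle_coord M (U, \<phi>)) w u H"
  unfolding coord_vec_bundle_expand[OF c u]
  by (simp add: symplectic_form_def ham_vec_def inner_vec_def sum.distrib sum_negf mult.commute)

text \<open>The differential of \<open>H\<close> does not depend on the chart and the symplectic form is invariant.
  Since the Jacobian of the transition is onto and the form is nondegenerate, the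
  Hamiltonian vectors of the two charts correspond to each other.\<close>

lemma ham_vec_invariant:
  assumes c: "(U, \<phi>) \<in> atlas M" and c': "(V, \<psi>) \<in> atlas M"
    and u: "u \<in> cotangent_over M U" "u \<in> cotangent_over M V"
  shows "coord_vec (cotangent_bundle M) (cotangent_over M U, bundle_coord M (U, \<phi>)) (ham_vec H (U, \<phi>) u) u
    = coord_vec (cotangent_bundle M) (cotangent_over M V, bundle_coord M (V, \<psi>)) (ham_vec H (V, \<psi>) u) u"
proof -
  let ?\<Phi> = "bundle_coord M (U, \<phi>)" and ?\<Psi> = "bundle_coord M (V, \<psi>)"
  let ?c = "coord_vec (cotangent_bundle M) (cotangent_over M U, ?\<Phi>)"
    and ?c' = "coord_vec (cotangent_bundle M) (cotangent_over M V, ?\<Psi>)"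
  define DT where "DT = frechet_derivative (?\<Psi> \<circ> inv_into (cotangent_over M U) ?\<Phi>) (at (?\<Phi> u))"
  define DT' where "DT' = frechet_derivative (?\<Phi> \<circ> inv_into (cotangent_over M V) ?\<Psi>) (at (?\<Psi> u))"
  note b = induced_chart_in_atlas[OF c] and b' = induced_chart_in_atlas[OF c']
  have z: "?\<Phi> u \<in> \<phi> ` (U \<inter> V) \<times> UNIV"
    unfolding bundle_coord_image[OF c, symmetric] using u by blast
  have change: "?c w u = ?c' (DT w) u" for w
    unfolding DT_def by (rule cot.coord_vec_change[OF b b' u])
  have onto: "DT (DT' w) = w" for w
    unfolding DT_def DT'_def by (rule cot.transition_derivative_inverse[OF b b' u])
  have "symplectic_form (DT (ham_vec H (U, \<phi>) u)) w = symplectic_form (ham_vec H (V, \<psi>) u) w" for w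
  proof -
    have "symplectic_form (DT (ham_vec H (U, \<phi>) u)) (DT (DT' w)) = symplectic_form (ham_vec H (U, \<phi>) u) (DT' w)"
      unfolding DT_def by (rule symplectic_form_invariant[OF c c' z])
    also have "\<dots> = ?c' (DT (DT' w)) u H"
      unfolding symplectic_form_ham_vec[OF c u(1)] change ..
    finally show ?thesis
      unfolding symplectic_form_ham_vec[OF c' u(2)] onto .
  qed
  then have "DT (ham_vec H (U, \<phi>) u) = ham_vec H (V, \<psi>) u"
    by (rule symplectic_form_nondegenerate)
  then show ?thesis using change by simp
qed

end

section \<open>The Hamiltonian vector field with external forces\<close>

context cotangent_atlas
begin

text \<open>The components, in the induced coordinates, of the vector field that the theorem calls $\xi$.\<close>

definition evolution_vec :: "('a cotangent \<Rightarrow> real) \<Rightarrow> ('a cotangent \<Rightarrow> 'a cotangent tvec)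
    \<Rightarrow> ('a, real^'n) chart \<Rightarrow> 'a cotangent \<Rightarrow> (real^'n) \<times> (real^'n)" where
  "evolution_vec H Fe c u = (1/2) *\<^sub>R (ham_vec H c u + (0, \<chi> i. force M Fe c i u))"

lemma local_field_eq_coord_vec:
  assumes c: "(U, \<phi>) \<in> atlas M" and u: "u \<in> cotangent_over M U"
  shows "local_field M H Fe (U, \<phi>) u
    = coord_vec (cotangent_bundle M) (cotangent_over M U, bundle_coord M (U, \<phi>)) (evolution_vec H Fe (U, \<phi>) u) u"
  by (rule ext)
    (simp add: local_field_def coord_vec_bundle_expand[OF c u] evolution_vec_def ham_vec_def
      sum_distrib_left algebra_simps)

text \<open>The force enters only through the sum $F_i\,\partial/\partial p_i$, which is \<open>Fe\<close> itself by
  verticality.  Hence the local expression is half the sum of the Hamiltonian vector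
  field and the given global field.\<close>

lemma local_field_eq_ham_vec_plus_force:
  assumes c: "(U, \<phi>) \<in> atlas M" and u: "u \<in> cotangent_over M U" and Fe: "vertical_field M Fe"
  shows "local_field M H Fe (U, \<phi>) u = (\<lambda>f. 1/2 * (coord_vec (cotangent_bundle M)
    (cotangent_over M U, bundle_coord M (U, \<phi>)) (ham_vec H (U, \<phi>) u) u f + Fe u f))"
proof (rule ext)
  fix f
  have "u \<in> fst (induced_chart M (U, \<phi>))" using u by (simp add: induced_chart_eq)
  then have "Fe u = (\<lambda>f. \<Sum>i\<in>UNIV. force M Fe (U, \<phi>) i u * dp M (U, \<phi>) i u f)"
    using Fe c unfolding vertical_field_def by blast
  then have "Fe u f = (\<Sum>i\<in>UNIV. force M Fe (U, \<phi>) i u * dp M (U, \<phi>) i u f)" by (rule fun_cong)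
  then show "local_field M H Fe (U, \<phi>) u f = 1/2 * (coord_vec (cotangent_bundle M)
      (cotangent_over M U, bundle_coord M (U, \<phi>)) (ham_vec H (U, \<phi>) u) u f + Fe u f)"
    by (simp add: local_field_def coord_vec_bundle_expand[OF c u] ham_vec_def
        sum.distrib[symmetric] algebra_simps)
qed

lemma local_field_invariant:
  assumes "(U, \<phi>) \<in> atlas M" "(V, \<psi>) \<in> atlas M" "vertical_field M Fe"
    and "u \<in> cotangent_over M U" "u \<in> cotangent_over M V"
  shows "local_field M H Fe (U, \<phi>) u = local_field M H Fe (V, \<psi>) u"
  using assms ham_vec_invariant[OF assms(1,2,4,5), of H]
  by (simp add: local_field_eq_ham_vec_plus_force)

text \<open>The force component \<open>F\<^sub>i\<close> is the value of the vector field \<open>Fe\<close> on the smooth function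
  \<open>p\<^sub>i\<close>.\<close>

lemma smooth_on_force:
  assumes c: "(U, \<phi>) \<in> atlas M" and Fe: "vertical_field M Fe"
  shows "smooth_on (bundle_coord M (U, \<phi>) ` cotangent_over M U)
    (\<lambda>z. force M Fe (U, \<phi>) i (inv_into (cotangent_over M U) (bundle_coord M (U, \<phi>)) z))"
proof -
  note b = induced_chart_in_atlas[OF c]
  have "bounded_linear (\<lambda>z::(real^'n) \<times> (real^'n). snd z $ i)"
    by (rule bounded_linear_compose[OF bounded_linear_vec_nth bounded_linear_snd])
  from cot.smooth_fun_on_coordinate[OF b this]
  have "smooth_fun_on (cotangent_bundle M) (cotangent_over M U) (pcoord M (U, \<phi>) i)"
    by (simp add: pcoord_eq)
  then have "smooth_fun_on (cotangent_bundle M) (cotangent_over M U) (\<lambda>u. Fe u (pcoord M (U, \<phi>) i))"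
    using Fe cot.openin_chart_domain[OF b] cot.chart_domain_subset[OF b]
    by (simp add: vertical_field_def vector_field_def)
  from cot.smooth_fun_on_chart[OF b this] show ?thesis
    by (simp add: force_def o_def)
qed

lemma smooth_on_partial_derivative:
  assumes c: "(U, \<phi>) \<in> atlas M" and f: "smooth_fun_on (cotangent_bundle M) W f"
    and W: "openin (mtop (cotangent_bundle M)) W"
  shows "smooth_on (bundle_coord M (U, \<phi>) ` (cotangent_over M U \<inter> W))
      (\<lambda>z. coord_vec (cotangent_bundle M) (cotangent_over M U, bundle_coord M (U, \<phi>)) b
        (inv_into (cotangent_over M U) (bundle_coord M (U, \<phi>)) z) f)"
proof -
  note b = induced_chart_in_atlas[OF c]
  show ?thesis
  proof (rule smooth_on_cong[OF cot.open_chart_image_Int[OF b W] _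
        smooth_on_frechet_derivative[OF cot.smooth_fun_on_chart[OF b f]]])
    fix z assume "z \<in> bundle_coord M (U, \<phi>) ` (cotangent_over M U \<inter> W)"
    then obtain u where u: "u \<in> cotangent_over M U" "u \<in> W" "z = bundle_coord M (U, \<phi>) u" by blast
    then have "smooth_near (cotangent_bundle M) u f" using f W by (auto simp: smooth_near_def)
    then show "frechet_derivative (f \<circ> inv_into (cotangent_over M U) (bundle_coord M (U, \<phi>))) (at z) b
      = coord_vec (cotangent_bundle M) (cotangent_over M U, bundle_coord M (U, \<phi>)) b
        (inv_into (cotangent_over M U) (bundle_coord M (U, \<phi>)) z) f"
      using u by (simp add: coord_vec_def cot.inv_chart[OF b])
  qed
qed

lemma smooth_on_evolution_vec:
  assumes c: "(U, \<phi>) \<in> atlas M" and Fe: "vertical_field M Fe"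
    and H: "smooth_fun_on (cotangent_bundle M) (slit_cotangent M) H"
  shows "smooth_on (bundle_coord M (U, \<phi>) ` (cotangent_over M U \<inter> slit_cotangent M))
    (\<lambda>z. evolution_vec H Fe (U, \<phi>) (inv_into (cotangent_over M U) (bundle_coord M (U, \<phi>)) z))"
    (is "smooth_on ?S _")
proof -
  let ?g = "inv_into (cotangent_over M U) (bundle_coord M (U, \<phi>))"
  have S: "open ?S"
    using cot.open_chart_image_Int[OF induced_chart_in_atlas[OF c] openin_slit_cotangent] .
  have dp: "smooth_on ?S (\<lambda>z. dp M (U, \<phi>) i (?g z) H)"
    and dx: "smooth_on ?S (\<lambda>z. dx M (U, \<phi>) i (?g z) H)" for i
    unfolding dp_def dx_def induced_chart_eq
    by (rule smooth_on_partial_derivative[OF c H openin_slit_cotangent])+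
  have F: "smooth_on ?S (\<lambda>z. force M Fe (U, \<phi>) i (?g z))" for i
    by (rule smooth_on_subset[OF smooth_on_force[OF c Fe]]) blast
  have "smooth_on ?S (\<lambda>z. (\<chi> i. 1/2 * dp M (U, \<phi>) i (?g z) H,
      \<chi> i. 1/2 * (force M Fe (U, \<phi>) i (?g z) + (- 1) * dx M (U, \<phi>) i (?g z) H)))"
    by (intro smooth_on_Pair[OF S] smooth_on_vec_lambda[OF S] smooth_on_mult[OF S smooth_on_const]
        smooth_on_add[OF S] dp dx F)
  moreover have "(\<chi> i. 1/2 * dp M (U, \<phi>) i u H, \<chi> i. 1/2 * (force M Fe (U, \<phi>) i u + (- 1) * dx M (U, \<phi>) i u H))
      = evolution_vec H Fe (U, \<phi>) u" for u
    by (simp add: evolution_vec_def ham_vec_def vec_eq_iff algebra_simps)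
  ultimately show ?thesis by simp
qed

lemma coord_vec_half:
  assumes c: "(U, \<phi>) \<in> atlas M" and u: "u \<in> cotangent_over M U" "u \<in> slit_cotangent M"
    and H: "smooth_fun_on (cotangent_bundle M) (slit_cotangent M) H"
  shows "coord_vec (cotangent_bundle M) (cotangent_over M U, bundle_coord M (U, \<phi>)) b u (\<lambda>w. 1/2 * H w)
    = 1/2 * coord_vec (cotangent_bundle M) (cotangent_over M U, bundle_coord M (U, \<phi>)) b u H"
proof -
  note b = induced_chart_in_atlas[OF c]
  let ?g = "inv_into (cotangent_over M U) (bundle_coord M (U, \<phi>))"
  have "smooth_fun_on (cotangent_bundle M) (slit_cotangent M) (\<lambda>w. 1/2 * H w)"
    unfolding smooth_fun_on_def
  proof clarify
    fix W \<theta> assume d: "(W, \<theta>) \<in> atlas (cotangent_bundle M)"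
    have "smooth_on (\<theta> ` (W \<inter> slit_cotangent M)) (\<lambda>z. 1/2 * (H \<circ> inv_into W \<theta>) z)"
      by (rule smooth_on_mult[OF cot.open_chart_image_Int[OF d openin_slit_cotangent] smooth_on_const
            cot.smooth_fun_on_chart[OF d H]])
    then show "smooth_on (\<theta> ` (W \<inter> slit_cotangent M)) ((\<lambda>w. 1/2 * H w) \<circ> inv_into W \<theta>)"
      by (simp add: o_def)
  qed
  then have near: "smooth_near (cotangent_bundle M) u H" "smooth_near (cotangent_bundle M) u (\<lambda>w. 1/2 * H w)"
    using u(2) H openin_slit_cotangent by (auto simp: smooth_near_def)
  have "frechet_derivative ((\<lambda>w. 1/2 * H w) \<circ> ?g) (at (bundle_coord M (U, \<phi>) u))
      = (\<lambda>b. 1/2 * frechet_derivative (H \<circ> ?g) (at (bundle_coord M (U, \<phi>) u)) b)"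
    using has_derivative_mult_right[OF cot.smooth_near_has_derivative[OF b near(1) u(1)], of "1/2"]
    by (intro frechet_derivative_at[symmetric]) (simp add: o_def)
  then show ?thesis using near by (simp add: coord_vec_def)
qed

lemma has_vector_derivative_bundle_coord_iff:
  fixes w :: "(real^'n) \<times> (real^'n)"
  shows "((bundle_coord M c \<circ> \<gamma>) has_vector_derivative w) (at t) \<longleftrightarrow>
    (\<forall>i. ((xcoord M c i \<circ> \<gamma>) has_real_derivative fst w $ i) (at t) \<and>
         ((pcoord M c i \<circ> \<gamma>) has_real_derivative snd w $ i) (at t))"
    (is "?L = ?R")
proof
  assume L: ?L
  have lin: "bounded_linear (\<lambda>z::(real^'n) \<times> (real^'n). fst z $ i)"
    "bounded_linear (\<lambda>z::(real^'n) \<times> (real^'n). snd z $ i)" for i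
    by (rule bounded_linear_compose[OF bounded_linear_vec_nth bounded_linear_fst]
        bounded_linear_compose[OF bounded_linear_vec_nth bounded_linear_snd])+
  show ?R
    using bounded_linear.has_vector_derivative[OF lin(1) L] bounded_linear.has_vector_derivative[OF lin(2) L]
    by (simp add: xcoord_eq pcoord_eq o_def has_real_derivative_iff_has_vector_derivative)
next
  assume R: ?R
  have vec: "((\<lambda>s. \<chi> i. f i s) has_vector_derivative v) (at t)"
    if "\<And>i. (f i has_real_derivative v $ i) (at t)" for f :: "'n \<Rightarrow> real \<Rightarrow> real" and v
  proof -
    have "((\<lambda>s. \<Sum>i\<in>UNIV. f i s *\<^sub>R axis i (1::real)) has_vector_derivative (\<Sum>i\<in>UNIV. v $ i *\<^sub>R axis i 1)) (at t)"
      by (intro has_vector_derivative_sum bounded_linear.has_vector_derivative[OF bounded_linear_scaleR_left])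
        (use that in \<open>simp add: has_real_derivative_iff_has_vector_derivative\<close>)
    moreover have "(\<Sum>i\<in>UNIV. f i s *\<^sub>R axis i (1::real)) = (\<chi> i. f i s)" for s
      using sum_axis[of "\<chi> i. f i s"] by simp
    ultimately show ?thesis by (simp add: sum_axis)
  qed
  have "((\<lambda>s. (\<chi> i. (xcoord M c i \<circ> \<gamma>) s, \<chi> i. (pcoord M c i \<circ> \<gamma>) s)) has_vector_derivative (fst w, snd w)) (at t)"
    using R by (intro has_vector_derivative_Pair vec) (simp_all add: o_def)
  moreover have "(\<chi> i. (xcoord M c i \<circ> \<gamma>) s, \<chi> i. (pcoord M c i \<circ> \<gamma>) s) = (bundle_coord M c \<circ> \<gamma>) s" for s
    by (simp add: xcoord_eq pcoord_eq prod_eq_iff)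
  ultimately show ?L by (simp add: o_def)
qed

text \<open>Hamilton's equations are the components of a single vector equation for the curve in the
  chart.\<close>

lemma hamilton_equations_iff:
  assumes c: "(U, \<phi>) \<in> atlas M" and u: "\<gamma> t \<in> cotangent_over M U" "\<gamma> t \<in> slit_cotangent M"
    and H: "smooth_fun_on (cotangent_bundle M) (slit_cotangent M) H"
  shows "hamilton_equations M H Fe (U, \<phi>) \<gamma> t \<longleftrightarrow>
    ((bundle_coord M (U, \<phi>) \<circ> \<gamma>) has_vector_derivative evolution_vec H Fe (U, \<phi>) (\<gamma> t)) (at t)"
proof -
  have real: "(f has_real_derivative d) (at t) \<longleftrightarrow> f differentiable (at t) \<and> deriv f t = d"
    for f :: "real \<Rightarrow> real" and d
    by (metis DERIV_deriv_iff_real_differentiable DERIV_imp_deriv real_differentiable_def)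
  have half: "dp M (U, \<phi>) i (\<gamma> t) (\<lambda>w. 1/2 * H w) = 1/2 * dp M (U, \<phi>) i (\<gamma> t) H"
    "dx M (U, \<phi>) i (\<gamma> t) (\<lambda>w. 1/2 * H w) = 1/2 * dx M (U, \<phi>) i (\<gamma> t) H" for i
    unfolding dp_def dx_def induced_chart_eq by (rule coord_vec_half[OF c u H])+
  have vec: "fst (evolution_vec H Fe (U, \<phi>) (\<gamma> t)) $ i = 1/2 * dp M (U, \<phi>) i (\<gamma> t) H"
    "snd (evolution_vec H Fe (U, \<phi>) (\<gamma> t)) $ i
      = 1/2 * force M Fe (U, \<phi>) i (\<gamma> t) - 1/2 * dx M (U, \<phi>) i (\<gamma> t) H" for i
    by (simp_all add: evolution_vec_def ham_vec_def algebra_simps)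
  show ?thesis
    unfolding has_vector_derivative_bundle_coord_iff real hamilton_equations_def half vec
    by (intro iff_allI) (auto simp: algebra_simps)
qed

text \<open>In a chart, the velocity of a curve has the derivative of its coordinate expression as
  components, and the components of a tangent vector are unique.  So the equation of the
  integral curves can be compared component by component.\<close>

lemma integral_curve_iff_hamilton_equations:
  assumes H: "smooth_fun_on (cotangent_bundle M) (slit_cotangent M) H"
    and X: "\<And>U \<phi> u. (U, \<phi>) \<in> atlas M \<Longrightarrow> u \<in> cotangent_over M U \<Longrightarrow> u \<in> slit_cotangent M
      \<Longrightarrow> X u = local_field M H Fe (U, \<phi>) u"
    and I: "open I" and \<gamma>: "continuous_map (top_of_set I) (mtop (cotangent_bundle M)) \<gamma>"
    and slit: "\<gamma> ` I \<subseteq> slit_cotangent M"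
  shows "integral_curve (cotangent_bundle M) X I \<gamma> \<longleftrightarrow>
    (\<forall>(U, \<phi>)\<in>atlas M. \<forall>t\<in>I. \<gamma> t \<in> cotangent_over M U \<longrightarrow> hamilton_equations M H Fe (U, \<phi>) \<gamma> t)"
proof
  assume int: "integral_curve (cotangent_bundle M) X I \<gamma>"
  show "\<forall>(U, \<phi>)\<in>atlas M. \<forall>t\<in>I. \<gamma> t \<in> cotangent_over M U \<longrightarrow> hamilton_equations M H Fe (U, \<phi>) \<gamma> t"
  proof clarify
    fix U \<phi> t assume c: "(U, \<phi>) \<in> atlas M" and t: "t \<in> I" "\<gamma> t \<in> cotangent_over M U"
    note b = induced_chart_in_atlas[OF c]
    have u: "\<gamma> t \<in> slit_cotangent M" using slit t by blast
    have "(bundle_coord M (U, \<phi>) \<circ> \<gamma>) differentiable (at t)"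
      using int b t unfolding integral_curve_def differentiable_curve_def by blast
    then obtain w where w: "((bundle_coord M (U, \<phi>) \<circ> \<gamma>) has_vector_derivative w) (at t)"
      using vector_derivative_works by blast
    have "coord_vec (cotangent_bundle M) (cotangent_over M U, bundle_coord M (U, \<phi>)) w (\<gamma> t)
        = velocity (cotangent_bundle M) \<gamma> t"
      using cot.velocity_eq_coord_vec[OF b I t(1) \<gamma> t(2) w] by simp
    also have "\<dots> = X (\<gamma> t)" using int t by (simp add: integral_curve_def)
    also have "\<dots> = coord_vec (cotangent_bundle M) (cotangent_over M U, bundle_coord M (U, \<phi>))
        (evolution_vec H Fe (U, \<phi>) (\<gamma> t)) (\<gamma> t)"
      using X[OF c t(2) u] local_field_eq_coord_vec[OF c t(2)] by simp
    finally have "w = evolution_vec H Fe (U, \<phi>) (\<gamma> t)" by (rule cot.coord_vec_inject[OF b t(2)])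
    then show "hamilton_equations M H Fe (U, \<phi>) \<gamma> t"
      using w hamilton_equations_iff[where \<gamma> = \<gamma> and t = t, OF c t(2) u H] by simp
  qed
next
  assume ham: "\<forall>(U, \<phi>)\<in>atlas M. \<forall>t\<in>I. \<gamma> t \<in> cotangent_over M U \<longrightarrow> hamilton_equations M H Fe (U, \<phi>) \<gamma> t"
  have d: "((bundle_coord M (U, \<phi>) \<circ> \<gamma>) has_vector_derivative evolution_vec H Fe (U, \<phi>) (\<gamma> t)) (at t)"
    if c: "(U, \<phi>) \<in> atlas M" and t: "t \<in> I" "\<gamma> t \<in> cotangent_over M U" for U \<phi> t
  proof -
    have "\<gamma> t \<in> slit_cotangent M" using slit t by blast
    moreover have "hamilton_equations M H Fe (U, \<phi>) \<gamma> t" using ham c t by blast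
    ultimately show ?thesis
      using hamilton_equations_iff[where \<gamma> = \<gamma> and t = t, OF c t(2) _ H] by simp
  qed
  show "integral_curve (cotangent_bundle M) X I \<gamma>"
    unfolding integral_curve_def differentiable_curve_def
  proof (intro conjI \<gamma> ballI)
    show "case d of (W, \<theta>) \<Rightarrow> \<forall>t\<in>I. \<gamma> t \<in> W \<longrightarrow> (\<theta> \<circ> \<gamma>) differentiable (at t)"
      if "d \<in> atlas (cotangent_bundle M)" for d
    proof -
      obtain U \<phi> where "(U, \<phi>) \<in> atlas M" "d = (cotangent_over M U, bundle_coord M (U, \<phi>))"
        using \<open>d \<in> _\<close> atlas_cotangent_bundle by blast
      then show ?thesis
        using d by (auto simp: has_vector_derivative_def differentiable_def)
    qed
    fix t assume t: "t \<in> I"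
    then have u: "\<gamma> t \<in> slit_cotangent M" using slit by blast
    then obtain U \<phi> where c: "(U, \<phi>) \<in> atlas M" and tU: "\<gamma> t \<in> cotangent_over M U"
      by (rule slit_cotangent_chart)
    have "velocity (cotangent_bundle M) \<gamma> t
        = coord_vec (cotangent_bundle M) (cotangent_over M U, bundle_coord M (U, \<phi>))
          (evolution_vec H Fe (U, \<phi>) (\<gamma> t)) (\<gamma> t)"
      by (rule cot.velocity_eq_coord_vec[OF induced_chart_in_atlas[OF c] I t \<gamma> tU d[OF c t tU]])
    also have "\<dots> = X (\<gamma> t)"
      using X[OF c tU u] local_field_eq_coord_vec[OF c tU] by simp
    finally show "velocity (cotangent_bundle M) \<gamma> t = X (\<gamma> t)" .
  qed
qed

lemma vector_field_evolution:
  assumes H: "smooth_fun_on (cotangent_bundle M) (slit_cotangent M) H" and Fe: "vertical_field M Fe"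
    and X: "\<And>U \<phi> u. (U, \<phi>) \<in> atlas M \<Longrightarrow> u \<in> cotangent_over M U \<Longrightarrow> u \<in> slit_cotangent M
      \<Longrightarrow> X u = local_field M H Fe (U, \<phi>) u"
  shows "vector_field (cotangent_bundle M) (slit_cotangent M) X"
proof (rule cot.vector_fieldI[OF openin_slit_cotangent])
  fix W \<theta> assume "(W, \<theta>) \<in> atlas (cotangent_bundle M)"
  then obtain U \<phi> where c: "(U, \<phi>) \<in> atlas M"
    and W: "W = cotangent_over M U" "\<theta> = bundle_coord M (U, \<phi>)"
    using atlas_cotangent_bundle by blast
  have "X u = coord_vec (cotangent_bundle M) (W, \<theta>) (evolution_vec H Fe (U, \<phi>) (inv_into W \<theta> (\<theta> u))) u"
    if "u \<in> W \<inter> slit_cotangent M" for u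
    using that X[OF c] local_field_eq_coord_vec[OF c] cot.inv_chart[OF induced_chart_in_atlas[OF c]]
    by (simp add: W)
  then show "\<exists>B. smooth_on (\<theta> ` (W \<inter> slit_cotangent M)) B \<and>
      (\<forall>u\<in>W \<inter> slit_cotangent M. X u = coord_vec (cotangent_bundle M) (W, \<theta>) (B (\<theta> u)) u)"
    using smooth_on_evolution_vec[OF c Fe H] unfolding W by blast
qed

end

theorem theorem4p2p1:
  fixes M :: "('a, real^'n) manifold"
    and H :: "'a cotangent \<Rightarrow> real"
    and Fe :: "'a cotangent \<Rightarrow> 'a cotangent tvec"
  assumes "mechanical_system M H Fe"
  shows "\<exists>\<xi>.
    (vector_field (cotangent_bundle M) (slit_cotangent M) \<xi> \<and>
      (\<forall>c\<in>atlas M. has_local_expression M H Fe c \<xi>)) \<and>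
    (\<forall>B \<eta>. B \<subseteq> atlas M \<and> (\<Union>c\<in>B. fst c) = topspace (mtop M) \<and>
      (\<forall>c\<in>B. has_local_expression M H Fe c \<eta>) \<longrightarrow> (\<forall>u\<in>slit_cotangent M. \<eta> u = \<xi> u)) \<and>
    (\<forall>I \<gamma>. open I \<and> is_interval I \<and>
      continuous_map (top_of_set I) (mtop (cotangent_bundle M)) \<gamma> \<and> \<gamma> ` I \<subseteq> slit_cotangent M \<longrightarrow>
      (integral_curve (cotangent_bundle M) \<xi> I \<gamma> \<longleftrightarrow>
        (\<forall>c\<in>atlas M. \<forall>t\<in>I. \<gamma> t \<in> fst (induced_chart M c) \<longrightarrow> hamilton_equations M H Fe c \<gamma> t)))"
proof -
  have H: "smooth_fun_on (cotangent_bundle M) (slit_cotangent M) H" and Fe: "vertical_field M Fe"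
    and "smooth_manifold M"
    using assms by (auto simp: mechanical_system_def hamilton_space_def)
  then interpret cotangent_atlas M
    by (simp add: cotangent_atlas_def smooth_manifold_imp_smooth_atlas)
  \<comment> \<open>The chart that is chosen at each point has no influence, because local expressions agree on
    overlaps.\<close>
  define \<xi> where "\<xi> u = local_field M H Fe (SOME c. c \<in> atlas M \<and> u \<in> fst (induced_chart M c)) u" for u
  have \<xi>: "\<xi> u = local_field M H Fe (U, \<phi>) u" if c: "(U, \<phi>) \<in> atlas M" "u \<in> cotangent_over M U" for U \<phi> u
  proof -
    let ?P = "\<lambda>c. c \<in> atlas M \<and> u \<in> fst (induced_chart M c)"
    obtain V \<psi> where V: "(SOME c. ?P c) = (V, \<psi>)" by (cases "SOME c. ?P c")
    have "?P (SOME c. ?P c)"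
      by (rule someI[of ?P "(U, \<phi>)"]) (simp add: c induced_chart_eq)
    then have "(V, \<psi>) \<in> atlas M" "u \<in> cotangent_over M V" unfolding V by (simp_all add: induced_chart_eq)
    then show ?thesis unfolding \<xi>_def V using local_field_invariant[OF _ c(1) Fe _ c(2)] by blast
  qed
  have local: "has_local_expression M H Fe c \<xi>" if "c \<in> atlas M" for c
    using that \<xi> by (cases c) (simp add: has_local_expression_def induced_chart_eq)
  have unique: "\<eta> u = \<xi> u"
    if B: "B \<subseteq> atlas M" "(\<Union>c\<in>B. fst c) = topspace (mtop M)" "\<forall>c\<in>B. has_local_expression M H Fe c \<eta>"
      and u: "u \<in> slit_cotangent M" for B \<eta> u
  proof -
    have "fst u \<in> (\<Union>c\<in>B. fst c)" unfolding B(2) using u by (auto simp: slit_cotangent_def)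
    then obtain U \<phi> where c: "(U, \<phi>) \<in> B" "fst u \<in> U" by auto
    then have "u \<in> fst (induced_chart M (U, \<phi>)) \<inter> slit_cotangent M"
      using u by (auto simp: induced_chart_eq slit_cotangent_def in_cotangent_over)
    moreover have "has_local_expression M H Fe (U, \<phi>) \<eta>" "has_local_expression M H Fe (U, \<phi>) \<xi>"
      using B c local by blast+
    ultimately show ?thesis unfolding has_local_expression_def by metis
  qed
  show ?thesis
  proof (intro exI[of _ \<xi>] conjI allI impI ballI)
    show "vector_field (cotangent_bundle M) (slit_cotangent M) \<xi>"
      by (rule vector_field_evolution[OF H Fe \<xi>])
    show "has_local_expression M H Fe c \<xi>" if "c \<in> atlas M" for c
      using that by (rule local)
    show "\<eta> u = \<xi> u"
      if "B \<subseteq> atlas M \<and> (\<Union>c\<in>B. fst c) = topspace (mtop M) \<and> (\<forall>c\<in>B. has_local_expression M H Fe c \<eta>)"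
        and "u \<in> slit_cotangent M" for B \<eta> u
      using that unique by blast
    fix I :: "real set" and \<gamma> :: "real \<Rightarrow> 'a cotangent"
    assume "open I \<and> is_interval I \<and>
      continuous_map (top_of_set I) (mtop (cotangent_bundle M)) \<gamma> \<and> \<gamma> ` I \<subseteq> slit_cotangent M"
    then have "integral_curve (cotangent_bundle M) \<xi> I \<gamma> \<longleftrightarrow>
        (\<forall>(U, \<phi>)\<in>atlas M. \<forall>t\<in>I. \<gamma> t \<in> cotangent_over M U \<longrightarrow> hamilton_equations M H Fe (U, \<phi>) \<gamma> t)"
      by (intro integral_curve_iff_hamilton_equations[OF H \<xi>]) auto
    then show "integral_curve (cotangent_bundle M) \<xi> I \<gamma> \<longleftrightarrow>
        (\<forall>c\<in>atlas M. \<forall>t\<in>I. \<gamma> t \<in> fst (induced_chart M c) \<longrightarrow> hamilton_equations M H Fe c \<gamma> t)"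
      by (auto simp: induced_chart_eq)
  qed
qed

end
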